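(* Let $P$ be an arbitrary finite poset and $K$ a field. Then all powers $H_P^k$ ($k\ge 1$) of the ideal $H_P$ have linear resolutions over $S$.
   Context: A poset ideal of a finite poset $P$ is a subset $I\subset P$ such that $x\in I$, $y\in P$, $y\le x$ imply $y\in I$ ($\emptyset$ and $P$ are poset ideals). $\mathcal{J}(P)$ is the set of all poset ideals of $P$, ordered by inclusion. Let $S=K[\{x_p,y_p\}_{p\in P}]$, a polynomial ring in $2|P|$ variables with $\deg x_p=\deg y_p=1$. For $I\in\mathcal{J}(P)$ set $u_I=\bigl(\prod_{p\in I}x_p\bigr)\bigl(\prod_{p\in P\setminus I}y_p\bigr)$, and let $H_P\subset S$ be the ideal generated by all $u_I$, $I\in\mathcal{J}(P)$. A graded ideal generated in a single degree $d$ has a linear resolution if for each $i$ the $i$th module in its minimal graded free $S$-resolution is a direct sum of copies of $S(-d-i)$. *)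

theory Defs
  imports
    "HOL-Library.Poly_Mapping"
    "HOL-Algebra.Module"
    "HOL-Algebra.Ideal_Product"
begin

section \<open>Polynomial rings\<close>

text \<open>
  A polynomial maps exponent vectors to coefficients; multiplication is the convolution product of
  \<^theory>\<open>HOL-Library.Poly_Mapping\<close>. The ring \<open>poly_ring V\<close> consists of the polynomials that involve
  only variables from the set \<open>V\<close> (not all of the type \<open>'v\<close>), so that \<open>V = {}\<close> gives the
  coefficient field itself.
\<close>

type_synonym ('v, 'k) mpoly = "('v \<Rightarrow>\<^sub>0 nat) \<Rightarrow>\<^sub>0 'k"

definition poly_ring :: "'v set \<Rightarrow> ('v, 'k::field) mpoly ring" where
  "poly_ring V =
     \<lparr>carrier = {f. \<forall>m\<in>Poly_Mapping.keys f. Poly_Mapping.keys m \<subseteq> V},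
      mult = (*), one = 1, zero = 0, add = (+)\<rparr>"

definition var :: "'v \<Rightarrow> ('v, 'k::field) mpoly" where
  "var v = Poly_Mapping.single (Poly_Mapping.single v 1) 1"

definition mon_deg :: "('v \<Rightarrow>\<^sub>0 nat) \<Rightarrow> nat" where
  "mon_deg m = (\<Sum>v\<in>Poly_Mapping.keys m. Poly_Mapping.lookup m v)"

text \<open>The zero polynomial is homogeneous of every degree.\<close>

definition homogeneous :: "nat \<Rightarrow> ('v, 'k::field) mpoly \<Rightarrow> bool" where
  "homogeneous d f \<longleftrightarrow> (\<forall>m\<in>Poly_Mapping.keys f. mon_deg m = d)"

definition max_graded_ideal :: "'v set \<Rightarrow> ('v, 'k::field) mpoly set" where
  "max_graded_ideal V = Idl\<^bsub>poly_ring V\<^esub> (var ` V)"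

definition generated_in_degree :: "'v set \<Rightarrow> ('v, 'k::field) mpoly set \<Rightarrow> nat \<Rightarrow> bool" where
  "generated_in_degree V I d \<longleftrightarrow>
     (\<exists>G \<subseteq> {f \<in> carrier (poly_ring V). homogeneous d f}. I = Idl\<^bsub>poly_ring V\<^esub> G)"


section \<open>Graded modules\<close>

text \<open>
  \<open>gr_comp M e\<close> is the homogeneous component of degree \<open>e\<close>. The modules that occur below live in
  degrees \<open>\<ge> 0\<close>, so components and shifts are indexed by natural numbers. The fields \<open>mult\<close> and
  \<open>one\<close>, inherited from the \<open>module\<close> record, play no role in the module structure.
\<close>

record ('a, 'b) graded_module = "('a, 'b) module" +
  gr_comp :: "nat \<Rightarrow> 'b set"

definition ideal_module ::
  "('v, 'k::field) mpoly set \<Rightarrow> (('v, 'k) mpoly, ('v, 'k) mpoly) graded_module" where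
  "ideal_module I =
     \<lparr>carrier = I, mult = (*), one = 1, zero = 0, add = (+), smult = (*),
      gr_comp = (\<lambda>e. {f \<in> I. homogeneous e f})\<rparr>"

text \<open>
  With \<open>S = poly_ring V\<close>, the graded free module \<open>S(-s\<^sub>0) \<oplus> \<dots> \<oplus> S(-s\<^sub>n\<^sub>-\<^sub>1)\<close> for the list of shifts
  \<open>ss = [s\<^sub>0, \<dots>, s\<^sub>n\<^sub>-\<^sub>1]\<close>. Its elements are coordinate vectors, extended by zero beyond the length of
  \<open>ss\<close>. Since \<open>S(-s)\<close> has \<open>S\<^sub>e\<^sub>-\<^sub>s\<close> as its component of degree \<open>e\<close>, a vector is homogeneous of degree
  \<open>e\<close> iff every monomial of its \<open>j\<close>-th coordinate has degree \<open>e - s\<^sub>j\<close>; this is written additively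
  to avoid truncated subtraction.
\<close>

definition free_module ::
  "'v set \<Rightarrow> nat list \<Rightarrow> (('v, 'k::field) mpoly, nat \<Rightarrow> ('v, 'k) mpoly) graded_module" where
  "free_module V ss =
     \<lparr>carrier = {w. (\<forall>j<length ss. w j \<in> carrier (poly_ring V)) \<and> (\<forall>j\<ge>length ss. w j = 0)},
      mult = (\<lambda>w w' j. w j * w' j), one = (\<lambda>j. if j < length ss then 1 else 0),
      zero = (\<lambda>j. 0), add = (\<lambda>w w' j. w j + w' j), smult = (\<lambda>f w j. f * w j),
      gr_comp = (\<lambda>e. {w. (\<forall>j<length ss. w j \<in> carrier (poly_ring V) \<and>
                             (\<forall>m\<in>Poly_Mapping.keys (w j). mon_deg m + ss ! j = e)) \<and>
                         (\<forall>j\<ge>length ss. w j = 0)})\<rparr>"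

definition graded_hom ::
  "('a, 'c) ring_scheme \<Rightarrow> ('a, 'm, 'd) graded_module_scheme \<Rightarrow>
   ('a, 'n, 'e) graded_module_scheme \<Rightarrow> ('m \<Rightarrow> 'n) set" where
  "graded_hom R M N =
     {h \<in> carrier M \<rightarrow> carrier N.
        (\<forall>x\<in>carrier M. \<forall>y\<in>carrier M. h (x \<oplus>\<^bsub>M\<^esub> y) = h x \<oplus>\<^bsub>N\<^esub> h y) \<and>
        (\<forall>a\<in>carrier R. \<forall>x\<in>carrier M. h (a \<odot>\<^bsub>M\<^esub> x) = a \<odot>\<^bsub>N\<^esub> h x) \<and>
        (\<forall>e. h ` gr_comp M e \<subseteq> gr_comp N e)}"


section \<open>Minimal graded free resolutions\<close>

text \<open>
  A complex \<open>\<dots> \<rightarrow> F\<^sub>2 \<rightarrow> F\<^sub>1 \<rightarrow> F\<^sub>0 \<rightarrow> I \<rightarrow> 0\<close> with \<open>F\<^sub>i = free_module V (sh i)\<close>, augmentation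
  \<open>aug : F\<^sub>0 \<rightarrow> I\<close> and differentials \<open>\<delta> i : F\<^sub>i\<^sub>+\<^sub>1 \<rightarrow> F\<^sub>i\<close>. A finite resolution has \<open>sh i = []\<close>,
  hence \<open>F\<^sub>i = 0\<close>, for all large \<open>i\<close>.
\<close>

definition graded_free_resolution ::
  "'v set \<Rightarrow> ('v, 'k::field) mpoly set \<Rightarrow> (nat \<Rightarrow> nat list) \<Rightarrow>
   ((nat \<Rightarrow> ('v, 'k) mpoly) \<Rightarrow> ('v, 'k) mpoly) \<Rightarrow>
   (nat \<Rightarrow> (nat \<Rightarrow> ('v, 'k) mpoly) \<Rightarrow> (nat \<Rightarrow> ('v, 'k) mpoly)) \<Rightarrow> bool" where
  "graded_free_resolution V I sh aug \<delta> \<longleftrightarrow>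
     (let F = (\<lambda>i. free_module V (sh i)) in
        aug \<in> graded_hom (poly_ring V) (F 0) (ideal_module I) \<and>
        (\<forall>i. \<delta> i \<in> graded_hom (poly_ring V) (F (Suc i)) (F i)) \<and>
        aug ` carrier (F 0) = I \<and>
        \<delta> 0 ` carrier (F 1) = a_kernel (F 0) (ideal_module I) aug \<and>
        (\<forall>i. \<delta> (Suc i) ` carrier (F (Suc (Suc i))) = a_kernel (F (Suc i)) (F i) (\<delta> i)))"

text \<open>
  Minimality: \<open>\<delta> i\<close> maps \<open>F\<^sub>i\<^sub>+\<^sub>1\<close> into \<open>\<mm> F\<^sub>i\<close>, the set of vectors all of whose coordinates lie in the
  graded maximal ideal \<open>\<mm>\<close>.
\<close>

definition minimal_graded_free_resolution ::
  "'v set \<Rightarrow> ('v, 'k::field) mpoly set \<Rightarrow> (nat \<Rightarrow> nat list) \<Rightarrow>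
   ((nat \<Rightarrow> ('v, 'k) mpoly) \<Rightarrow> ('v, 'k) mpoly) \<Rightarrow>
   (nat \<Rightarrow> (nat \<Rightarrow> ('v, 'k) mpoly) \<Rightarrow> (nat \<Rightarrow> ('v, 'k) mpoly)) \<Rightarrow> bool" where
  "minimal_graded_free_resolution V I sh aug \<delta> \<longleftrightarrow>
     graded_free_resolution V I sh aug \<delta> \<and>
     (\<forall>i. \<forall>w\<in>carrier (free_module V (sh (Suc i))).
        \<forall>j<length (sh i). \<delta> i w j \<in> max_graded_ideal V)"

text \<open>
  The minimal graded free resolution is unique up to isomorphism of graded complexes, so the lists
  \<open>sh i\<close> are determined up to order and it does not matter which minimal resolution is chosen.
\<close>

definition has_linear_resolution :: "'v set \<Rightarrow> ('v, 'k::field) mpoly set \<Rightarrow> bool" where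
  "has_linear_resolution V I \<longleftrightarrow>
     (\<exists>d. generated_in_degree V I d \<and>
          (\<exists>sh aug \<delta>. minimal_graded_free_resolution V I sh aug \<delta> \<and>
                      (\<forall>i. \<forall>s\<in>set (sh i). s = d + i)))"


section \<open>The ideal of a finite poset\<close>

text \<open>A poset is a carrier set \<open>P\<close> with a relation \<open>r\<close>, where \<open>(y, x) \<in> r\<close> means \<open>y \<le> x\<close>.\<close>

definition poset_ideals :: "'p set \<Rightarrow> 'p rel \<Rightarrow> 'p set set" where
  "poset_ideals P r = {I. I \<subseteq> P \<and> (\<forall>x\<in>I. \<forall>y\<in>P. (y, x) \<in> r \<longrightarrow> y \<in> I)}"

datatype 'p xy = X 'p | Y 'p

definition xy_vars :: "'p set \<Rightarrow> 'p xy set" where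
  "xy_vars P = X ` P \<union> Y ` P"

definition u_monomial :: "'p set \<Rightarrow> 'p set \<Rightarrow> ('p xy, 'k::field) mpoly" where
  "u_monomial P I = (\<Prod>p\<in>I. var (X p)) * (\<Prod>p\<in>P - I. var (Y p))"

definition H_ideal :: "'p set \<Rightarrow> 'p rel \<Rightarrow> ('p xy, 'k::field) mpoly set" where
  "H_ideal P r = Idl\<^bsub>poly_ring (xy_vars P)\<^esub> (u_monomial P ` poset_ideals P r)"


section \<open>Sanity checks\<close>

lemma keys_minus_mpoly: "Poly_Mapping.keys (- f :: ('v, 'k::field) mpoly) = Poly_Mapping.keys f"
  by (simp add: in_keys_iff set_eq_iff)

lemma poly_ring_add_closed:
  "f \<in> carrier (poly_ring V) \<Longrightarrow> g \<in> carrier (poly_ring V) \<Longrightarrow> f + g \<in> carrier (poly_ring V)"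
  using Poly_Mapping.keys_add[of f g] by (fastforce simp: poly_ring_def)

lemma poly_ring_uminus_closed: "f \<in> carrier (poly_ring V) \<Longrightarrow> - f \<in> carrier (poly_ring V)"
  by (simp add: poly_ring_def keys_minus_mpoly)

lemma poly_ring_mult_closed:
  assumes "f \<in> carrier (poly_ring V)" "g \<in> carrier (poly_ring V)"
  shows "f * g \<in> carrier (poly_ring V)"
proof -
  have "Poly_Mapping.keys m \<subseteq> V" if m: "m \<in> Poly_Mapping.keys (f * g)" for m
  proof -
    obtain a b where "m = a + b" "a \<in> Poly_Mapping.keys f" "b \<in> Poly_Mapping.keys g"
      using m Poly_Mapping.keys_mult[of f g] by blast
    then show ?thesis
      using assms Poly_Mapping.keys_add[of a b] by (fastforce simp: poly_ring_def)
  qed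
  then show ?thesis by (simp add: poly_ring_def)
qed

lemma poly_ring_simps [simp]:
  "mult (poly_ring V) = (*)" "one (poly_ring V) = 1"
  "zero (poly_ring V) = 0" "add (poly_ring V) = (+)"
  by (simp_all add: poly_ring_def)

lemma zero_in_poly_ring: "0 \<in> carrier (poly_ring V)"
  and one_in_poly_ring: "1 \<in> carrier (poly_ring V)"
  by (simp_all add: poly_ring_def)

lemma cring_poly_ring: "cring (poly_ring V)"
proof (rule cringI)
  show "abelian_group (poly_ring V)"
  proof (rule abelian_groupI)
    fix x
    assume "x \<in> carrier (poly_ring V)"
    then show "\<exists>y\<in>carrier (poly_ring V). y \<oplus>\<^bsub>poly_ring V\<^esub> x = \<zero>\<^bsub>poly_ring V\<^esub>"
      by (intro bexI[of _ "- x"]) (auto intro: poly_ring_uminus_closed)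
  qed (auto simp: algebra_simps intro: poly_ring_add_closed zero_in_poly_ring)
  show "Group.comm_monoid (poly_ring V)"
    by (rule comm_monoidI)
      (auto simp: algebra_simps intro: poly_ring_mult_closed one_in_poly_ring)
qed (auto simp: algebra_simps)

lemma module_free_module: "Module.module (poly_ring V) (free_module V ss)"
proof (rule moduleI)
  show "abelian_group (free_module V ss)"
  proof (rule abelian_groupI)
    fix x
    assume "x \<in> carrier (free_module V ss)"
    then show "\<exists>y\<in>carrier (free_module V ss).
        y \<oplus>\<^bsub>free_module V ss\<^esub> x = \<zero>\<^bsub>free_module V ss\<^esub>"
      by (intro bexI[of _ "\<lambda>j. - x j"]) (auto simp: free_module_def intro: poly_ring_uminus_closed)
  qed (auto simp: free_module_def algebra_simps intro: poly_ring_add_closed zero_in_poly_ring)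
qed (auto simp: free_module_def algebra_simps cring_poly_ring intro: poly_ring_mult_closed)

lemma module_ideal_module:
  assumes "ideal I (poly_ring V)"
  shows "Module.module (poly_ring V) (ideal_module I)"
proof -
  interpret ideal I "poly_ring V" by (fact assms)
  have minus: "- x \<in> I" if "x \<in> I" for x
  proof -
    have "- 1 \<in> carrier (poly_ring V)"
      by (intro poly_ring_uminus_closed one_in_poly_ring)
    from I_l_closed[OF that this] show ?thesis by simp
  qed
  show ?thesis
  proof (rule moduleI)
    show "abelian_group (ideal_module I)"
    proof (rule abelian_groupI)
      fix x assume "x \<in> carrier (ideal_module I)"
      then show "\<exists>y\<in>carrier (ideal_module I). y \<oplus>\<^bsub>ideal_module I\<^esub> x = \<zero>\<^bsub>ideal_module I\<^esub>"
        by (intro bexI[of _ "- x"]) (auto simp: ideal_module_def minus)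
    qed (use additive_subgroup.a_closed[OF is_additive_subgroup]
        additive_subgroup.zero_closed[OF is_additive_subgroup] in \<open>auto simp: ideal_module_def algebra_simps\<close>)
  qed (use I_l_closed in \<open>auto simp: ideal_module_def distrib_left distrib_right mult.assoc cring_poly_ring\<close>)
qed

lemma var_in_poly_ring: "v \<in> V \<Longrightarrow> var v \<in> carrier (poly_ring V)"
  by (simp add: var_def poly_ring_def)

lemma prod_in_poly_ring:
  "(\<And>i. i \<in> A \<Longrightarrow> f i \<in> carrier (poly_ring V)) \<Longrightarrow> prod f A \<in> carrier (poly_ring V)"
  by (induction A rule: infinite_finite_induct)
    (simp_all add: one_in_poly_ring poly_ring_mult_closed)

lemma u_monomial_in_poly_ring:
  "I \<in> poset_ideals P r \<Longrightarrow> u_monomial P I \<in> carrier (poly_ring (xy_vars P))"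
  unfolding u_monomial_def
  by (intro poly_ring_mult_closed prod_in_poly_ring var_in_poly_ring)
    (auto simp: poset_ideals_def xy_vars_def)

lemma ideal_H_ideal: "ideal (H_ideal P r) (poly_ring (xy_vars P))"
proof -
  interpret cring "poly_ring (xy_vars P)" by (rule cring_poly_ring)
  show ?thesis
    unfolding H_ideal_def by (rule genideal_ideal) (auto intro: u_monomial_in_poly_ring)
qed

end

theory Submission
  imports Defs
begin

text \<open>
  The power \<open>H_P ^ k\<close> is generated by the monomials \<open>u_a = \<Prod>p\<in>P. x_p ^ a p * y_p ^ (k - a p)\<close>, where \<open>a\<close>
  runs through the order reversing maps from \<open>P\<close> to \<open>{0..k}\<close>. It is resolved by a cubical complex.
  Its cells are the pairs \<open>(a, T)\<close> such that \<open>a\<close> may be decreased by one at every \<open>t \<in> T\<close>, and the cell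
  stands for the cube of the maps \<open>a - 1_U\<close>, \<open>U \<subseteq> T\<close>. The face \<open>(a, T - t)\<close> has coefficient \<open>y_t\<close> and the
  face \<open>(a - 1_t, T - t)\<close> has coefficient \<open>- x_t\<close>, up to a common sign. All entries are linear, so the
  complex is minimal and linear once it is exact.

  For exactness, let \<open>z\<close> be a cycle and \<open>a\<close> a map of maximal sum in its support. The \<open>a\<close>-part of \<open>z\<close> is
  a cycle of the Koszul complex on the variables \<open>y_t\<close> for which \<open>a - 1_t\<close> is order reversing, hence a
  Koszul boundary. In homological degree 0 this uses that these variables generate the ideal
  \<open>(u_b | b \<noteq> a, sum b \<le> sum a) : u_a\<close>. Subtracting a boundary removes \<open>a\<close> from the support.
\<close>

section \<open>Polynomials and ideals\<close>

lemma lookup_single_mult_add: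
  fixes f :: "('v, 'k::field) mpoly"
  shows "Poly_Mapping.lookup (Poly_Mapping.single a 1 * f) (a + m) = Poly_Mapping.lookup f m"
  by (simp add: lookup_mult lookup_single when_mult)

lemma lookup_single_mult_eq_0:
  fixes f :: "('v, 'k::field) mpoly"
  assumes "\<And>m. k \<noteq> a + m"
  shows "Poly_Mapping.lookup (Poly_Mapping.single a 1 * f) k = 0"
  using assms by (simp add: lookup_mult lookup_single when_mult)

lemma exponent_split:
  assumes "Poly_Mapping.lookup m v \<noteq> (0::nat)"
  obtains m' where "m = Poly_Mapping.single v 1 + m'"
proof
  show "m = Poly_Mapping.single v 1 + (m - Poly_Mapping.single v 1)"
    using assms by (intro poly_mapping_eqI) (auto simp: lookup_add lookup_minus lookup_single when_def)
qed

lemma lookup_var_mult_add: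
  "Poly_Mapping.lookup (var v * f) (Poly_Mapping.single v 1 + m) = Poly_Mapping.lookup f m"
  unfolding var_def by (rule lookup_single_mult_add)

lemma lookup_var_mult_eq_0:
  assumes "Poly_Mapping.lookup m v = 0"
  shows "Poly_Mapping.lookup (var v * f) m = 0"
  unfolding var_def
  by (rule lookup_single_mult_eq_0) (use assms in \<open>auto simp: lookup_add\<close>)

text \<open>Quotient of division by a variable: reading the coefficients along an injective shift of
  exponents keeps the monomials divisible by \<open>v\<close>, with one \<open>v\<close> removed,
  and drops all others. This is the building block of the Koszul homotopy used for
  exactness.\<close>

definition div_var :: "'v \<Rightarrow> ('v, 'k::field) mpoly \<Rightarrow> ('v, 'k) mpoly" where
  "div_var v f = Poly_Mapping.map_key (\<lambda>m. Poly_Mapping.single v 1 + m) f"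

lemma inj_add_exponent: "inj (\<lambda>m. Poly_Mapping.single v (1::nat) + m)"
  by (simp add: inj_def)

lemma lookup_div_var:
  "Poly_Mapping.lookup (div_var v f) m = Poly_Mapping.lookup f (Poly_Mapping.single v 1 + m)"
  by (simp add: div_var_def Poly_Mapping.map_key.rep_eq[OF inj_add_exponent] del: One_nat_def)

lemma div_var_0 [simp]: "div_var v 0 = 0"
  by (rule poly_mapping_eqI) (simp add: lookup_div_var)

lemma div_var_add: "div_var v (f + g) = div_var v f + div_var v g"
  by (rule poly_mapping_eqI) (simp add: lookup_div_var lookup_add)

lemma div_var_uminus: "div_var v (- f) = - div_var v f"
  by (rule poly_mapping_eqI) (simp add: lookup_div_var)

lemma div_var_sum: "div_var v (sum f A) = (\<Sum>i\<in>A. div_var v (f i))"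
  by (induction A rule: infinite_finite_induct) (simp_all add: div_var_add)

lemma div_var_mult_self: "div_var v (var v * f) = f"
  by (rule poly_mapping_eqI) (simp add: lookup_div_var lookup_var_mult_add del: One_nat_def)

text \<open>A factor \<open>u\<close> other than \<open>v\<close> does not affect divisibility by
  \<open>v\<close>. Hence division by \<open>Y t\<close> passes through those Koszul terms that
  carry a different \<open>Y s\<close>.\<close>

lemma div_var_mult_other:
  assumes "u \<noteq> v"
  shows "div_var v (var u * f) = var u * div_var v f"
proof (rule poly_mapping_eqI)
  fix m
  show "Poly_Mapping.lookup (div_var v (var u * f)) m = Poly_Mapping.lookup (var u * div_var v f) m"
  proof (cases "Poly_Mapping.lookup m u = 0")
    case True
    then have "Poly_Mapping.lookup (Poly_Mapping.single v 1 + m) u = 0"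
      using assms by (simp add: lookup_add lookup_single)
    with True show ?thesis by (simp add: lookup_div_var lookup_var_mult_eq_0)
  next
    case False
    then obtain m' where m: "m = Poly_Mapping.single u 1 + m'" by (rule exponent_split)
    have "Poly_Mapping.single v 1 + m = Poly_Mapping.single u 1 + (Poly_Mapping.single v 1 + m')"
      by (simp add: m ac_simps)
    then show ?thesis unfolding lookup_div_var by (simp only: m lookup_var_mult_add lookup_div_var)
  qed
qed

text \<open>Subtracting \<open>var v * div_var v f\<close> deletes the monomials divisible by
  \<open>v\<close> and leaves the others untouched. As the remainder has no new monomials, several
  variables can be cleared one after another.\<close>

lemma keys_diff_var_mult_div_var:
  assumes "m \<in> Poly_Mapping.keys (f - var v * div_var v f)"
  shows "m \<in> Poly_Mapping.keys f \<and> Poly_Mapping.lookup m v = 0"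
proof (cases "Poly_Mapping.lookup m v = 0")
  case True
  then show ?thesis using assms
    by (simp add: in_keys_iff lookup_minus lookup_var_mult_eq_0)
next
  case False
  then obtain m' where m: "m = Poly_Mapping.single v 1 + m'" by (rule exponent_split)
  then have "Poly_Mapping.lookup (f - var v * div_var v f) m = 0"
    by (simp only: m lookup_minus lookup_var_mult_add lookup_div_var diff_self)
  then show ?thesis using assms by (simp add: in_keys_iff)
qed

section \<open>Closure properties of the polynomial ring and degrees of monomials\<close>

lemma poly_ring_diff_closed:
  "f \<in> carrier (poly_ring V) \<Longrightarrow> g \<in> carrier (poly_ring V) \<Longrightarrow> f - g \<in> carrier (poly_ring V)"
  using poly_ring_add_closed[of f V "- g"] poly_ring_uminus_closed[of g V] by simp

lemma poly_ring_sum_closed: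
  "(\<And>i. i \<in> A \<Longrightarrow> f i \<in> carrier (poly_ring V)) \<Longrightarrow> sum f A \<in> carrier (poly_ring V)"
  by (induction A rule: infinite_finite_induct)
    (simp_all add: zero_in_poly_ring poly_ring_add_closed)

lemma div_var_in_poly_ring:
  assumes "f \<in> carrier (poly_ring V)"
  shows "div_var v f \<in> carrier (poly_ring V)"
proof -
  have "Poly_Mapping.keys m \<subseteq> V" if "m \<in> Poly_Mapping.keys (div_var v f)" for m
  proof -
    have "Poly_Mapping.keys (Poly_Mapping.single v 1 + m) \<subseteq> V"
      using that assms by (auto simp: in_keys_iff lookup_div_var poly_ring_def)
    then show ?thesis by (auto simp: in_keys_iff lookup_add)
  qed
  then show ?thesis by (simp add: poly_ring_def)
qed

lemma mon_deg_eq_sum: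
  assumes "finite A" "Poly_Mapping.keys m \<subseteq> A"
  shows "mon_deg m = (\<Sum>v\<in>A. Poly_Mapping.lookup m v)"
  unfolding mon_deg_def by (rule sum.mono_neutral_left) (use assms in \<open>auto simp: in_keys_iff\<close>)

lemma mon_deg_add: "mon_deg (a + b) = mon_deg a + mon_deg b"
proof -
  let ?A = "Poly_Mapping.keys a \<union> Poly_Mapping.keys b"
  have "mon_deg (a + b) = (\<Sum>v\<in>?A. Poly_Mapping.lookup (a + b) v)"
    using Poly_Mapping.keys_add[of a b] by (intro mon_deg_eq_sum) auto
  also have "\<dots> = mon_deg a + mon_deg b"
    by (simp add: lookup_add sum.distrib mon_deg_eq_sum[of ?A])
  finally show ?thesis .
qed

lemma mon_deg_single [simp]: "mon_deg (Poly_Mapping.single v n) = n"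
  by (simp add: mon_deg_def)

lemma mon_deg_sum: "mon_deg (sum f A) = (\<Sum>i\<in>A. mon_deg (f i))"
  by (induction A rule: infinite_finite_induct) (simp_all add: mon_deg_add, simp_all add: mon_deg_def)

lemma keys_single_mult:
  fixes f :: "('v, 'k::field) mpoly"
  shows "m \<in> Poly_Mapping.keys (Poly_Mapping.single a 1 * f) \<longleftrightarrow> (\<exists>m'\<in>Poly_Mapping.keys f. m = a + m')"
proof
  assume m: "m \<in> Poly_Mapping.keys (Poly_Mapping.single a 1 * f)"
  show "\<exists>m'\<in>Poly_Mapping.keys f. m = a + m'"
    using m lookup_single_mult_eq_0[of m a f] lookup_single_mult_add[of a f]
    by (metis in_keys_iff)
qed (auto simp: in_keys_iff lookup_single_mult_add)

lemma keys_var_mult: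
  "m \<in> Poly_Mapping.keys (var v * f) \<longleftrightarrow>
     (\<exists>m'\<in>Poly_Mapping.keys f. m = Poly_Mapping.single v 1 + m')"
  unfolding var_def by (rule keys_single_mult)

section \<open>Generators of ideals and of products of ideals\<close>

lemma Idl_image_eq_sums:
  fixes g :: "'c \<Rightarrow> ('v, 'k::field) mpoly"
  assumes fin: "finite A" and g: "\<And>a. a \<in> A \<Longrightarrow> g a \<in> carrier (poly_ring V)"
  shows "Idl\<^bsub>poly_ring V\<^esub> (g ` A) = {\<Sum>a\<in>A. f a * g a | f. \<forall>a. f a \<in> carrier (poly_ring V)}"
    (is "_ = ?R")
proof
  interpret cring "poly_ring V :: ('v, 'k) mpoly ring" by (rule cring_poly_ring)
  have "ideal ?R (poly_ring V)"
  proof (rule idealI)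
    show "subgroup ?R (add_monoid (poly_ring V))"
    proof
      show "?R \<subseteq> carrier (add_monoid (poly_ring V))"
        using g by (auto intro!: poly_ring_sum_closed poly_ring_mult_closed)
      show "x \<otimes>\<^bsub>add_monoid (poly_ring V)\<^esub> y \<in> ?R" if xy: "x \<in> ?R" "y \<in> ?R" for x y
      proof -
        obtain f f' where f: "x = (\<Sum>a\<in>A. f a * g a)" "y = (\<Sum>a\<in>A. f' a * g a)"
            "\<forall>a. f a \<in> carrier (poly_ring V)" "\<forall>a. f' a \<in> carrier (poly_ring V)"
          using xy by auto
        have "x + y = (\<Sum>a\<in>A. (f a + f' a) * g a)"
          by (simp add: f(1,2) sum.distrib distrib_right)
        moreover have "\<forall>a. f a + f' a \<in> carrier (poly_ring V)"
          using f(3,4) by (auto intro: poly_ring_add_closed)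
        ultimately show ?thesis
          by (simp, intro exI[of _ "\<lambda>a. f a + f' a"]) simp
      qed
      show "\<one>\<^bsub>add_monoid (poly_ring V)\<^esub> \<in> ?R"
        by (simp, intro exI[of _ "\<lambda>a. 0"]) (simp add: zero_in_poly_ring)
      show "inv\<^bsub>add_monoid (poly_ring V)\<^esub> x \<in> ?R" if x: "x \<in> ?R" for x
      proof -
        obtain f where f: "x = (\<Sum>a\<in>A. f a * g a)" "\<forall>a. f a \<in> carrier (poly_ring V)"
          using x by blast
        have x: "x \<in> carrier (poly_ring V)"
          unfolding f(1) using f(2) g by (auto intro!: poly_ring_sum_closed poly_ring_mult_closed)
        have "inv\<^bsub>add_monoid (poly_ring V)\<^esub> x = - x"
          using minus_equality[of "- x" x] x poly_ring_uminus_closed[OF x] by (simp add: a_inv_def)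
        also have "\<dots> = (\<Sum>a\<in>A. (- f a) * g a)" by (simp add: f(1) sum_negf)
        finally show ?thesis
          using f(2) poly_ring_uminus_closed by (simp, intro exI[of _ "\<lambda>a. - f a"]) auto
      qed
    qed
    fix x y :: "('v, 'k) mpoly"
    assume x: "x \<in> ?R" and y: "y \<in> carrier (poly_ring V)"
    then obtain f where f: "x = (\<Sum>a\<in>A. f a * g a)" "\<forall>a. f a \<in> carrier (poly_ring V)" by auto
    have "y * x = (\<Sum>a\<in>A. (y * f a) * g a)" by (simp add: f(1) sum_distrib_left mult.assoc)
    moreover have "\<forall>a. y * f a \<in> carrier (poly_ring V)"
      using f(2) y by (auto intro: poly_ring_mult_closed)
    ultimately have "y * x \<in> ?R"
      by (simp only: mem_Collect_eq) (rule exI[of _ "\<lambda>a. y * f a"], simp)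
    then show "y \<otimes>\<^bsub>poly_ring V\<^esub> x \<in> ?R" "x \<otimes>\<^bsub>poly_ring V\<^esub> y \<in> ?R"
      by (simp_all add: mult.commute)
  qed (rule ring_axioms)
  moreover have "g ` A \<subseteq> ?R"
  proof
    fix x assume "x \<in> g ` A"
    then obtain a where a: "a \<in> A" "x = g a" by auto
    have "x = (\<Sum>b\<in>A. (if b = a then 1 else 0) * g b)"
      using a fin by (simp add: if_distrib[of "\<lambda>c. c * _"] sum.delta cong: if_cong)
    then show "x \<in> ?R"
      using zero_in_poly_ring one_in_poly_ring
      by (simp, intro exI[of _ "\<lambda>b. if b = a then 1 else 0"]) auto
  qed
  ultimately show "Idl\<^bsub>poly_ring V\<^esub> (g ` A) \<subseteq> ?R" by (rule genideal_minimal)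
  have gA: "g ` A \<subseteq> carrier (poly_ring V)" using g by auto
  interpret I: ideal "Idl\<^bsub>poly_ring V\<^esub> (g ` A)" "poly_ring V" by (rule genideal_ideal[OF gA])
  have mem: "f a * g a \<in> Idl\<^bsub>poly_ring V\<^esub> (g ` A)" if "a \<in> A" "f a \<in> carrier (poly_ring V)" for f a
    using I.I_l_closed[of "g a" "f a"] genideal_self[OF gA] that by auto
  have "(\<Sum>a\<in>B. f a * g a) \<in> Idl\<^bsub>poly_ring V\<^esub> (g ` A)"
    if "finite B" "B \<subseteq> A" "\<forall>a. f a \<in> carrier (poly_ring V)" for B f
    using that I.additive_subgroup_axioms additive_subgroup.zero_closed[OF I.additive_subgroup_axioms]
      additive_subgroup.a_closed[OF I.additive_subgroup_axioms] mem
    by (induction B rule: finite_induct) auto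
  then show "?R \<subseteq> Idl\<^bsub>poly_ring V\<^esub> (g ` A)" using fin by blast
qed

text \<open>Serves to pass from generators to ideals: once the colon set contains a generating set,
  minimality of \<open>Idl\<close> puts the whole ideal into it.\<close>

lemma (in cring) colon_ideal:
  assumes J: "ideal J R" and A: "A \<subseteq> carrier R"
  shows "ideal {x \<in> carrier R. \<forall>a\<in>A. a \<otimes> x \<in> J} R"
proof -
  interpret J: ideal J R by (fact J)
  show ?thesis
  proof (rule idealI)
    show "subgroup {x \<in> carrier R. \<forall>a\<in>A. a \<otimes> x \<in> J} (add_monoid R)"
    proof
      fix x assume x: "x \<in> {x \<in> carrier R. \<forall>a\<in>A. a \<otimes> x \<in> J}"
      have "a \<otimes> (\<ominus> x) \<in> J" if "a \<in> A" for a
      proof -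
        have "a \<otimes> (\<ominus> x) = \<ominus> (a \<otimes> x)" using x that A by (auto simp: r_minus)
        then show ?thesis using x that by (simp add: J.a_inv_closed)
      qed
      then show "inv\<^bsub>add_monoid R\<^esub> x \<in> {x \<in> carrier R. \<forall>a\<in>A. a \<otimes> x \<in> J}"
        using x by (simp flip: a_inv_def)
    qed (use A in \<open>auto simp: r_distr subset_iff intro!: J.a_closed\<close>)
  next
    fix x y assume x: "x \<in> {x \<in> carrier R. \<forall>a\<in>A. a \<otimes> x \<in> J}" and y: "y \<in> carrier R"
    have "a \<otimes> (y \<otimes> x) \<in> J" if "a \<in> A" for a
    proof -
      have "a \<otimes> (y \<otimes> x) = y \<otimes> (a \<otimes> x)" using x y that A m_lcomm by auto
      then show ?thesis using x y that by (simp add: J.I_l_closed)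
    qed
    then show "y \<otimes> x \<in> {x \<in> carrier R. \<forall>a\<in>A. a \<otimes> x \<in> J}"
      and "x \<otimes> y \<in> {x \<in> carrier R. \<forall>a\<in>A. a \<otimes> x \<in> J}"
      using x y by (auto simp: m_comm)
  qed (rule ring_axioms)
qed

text \<open>For the inclusion of the product ideal, the colon ideal of \<open>Idl (G <#> H)\<close>
  is used twice, first by \<open>G\<close> to extend from \<open>H\<close> to \<open>Idl H\<close>,
  then by \<open>Idl H\<close> to extend from \<open>G\<close> to \<open>Idl G\<close>.\<close>

lemma (in cring) ideal_prod_genideal:
  assumes G: "G \<subseteq> carrier R" and H: "H \<subseteq> carrier R"
  shows "ideal_prod R (Idl G) (Idl H) = Idl (G <#> H)"
proof
  have GH: "G <#> H \<subseteq> carrier R" by (rule set_mult_closed[OF G H])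
  interpret GH: ideal "Idl (G <#> H)" R by (rule genideal_ideal[OF GH])
  let ?A = "{x \<in> carrier R. \<forall>a\<in>G. a \<otimes> x \<in> Idl (G <#> H)}"
  have "Idl H \<subseteq> ?A"
  proof (rule genideal_minimal[OF colon_ideal[OF GH.ideal_axioms G]])
    show "H \<subseteq> ?A" using H genideal_self[OF GH] by (auto simp: set_mult_def)
  qed
  moreover have H': "Idl H \<subseteq> carrier R" using ideal.Icarr[OF genideal_ideal[OF H]] by blast
  ultimately have "G \<subseteq> {x \<in> carrier R. \<forall>a\<in>Idl H. a \<otimes> x \<in> Idl (G <#> H)}"
    using G m_comm by (fastforce simp: subset_iff)
  then have "Idl G \<subseteq> {x \<in> carrier R. \<forall>a\<in>Idl H. a \<otimes> x \<in> Idl (G <#> H)}"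
    by (rule genideal_minimal[OF colon_ideal[OF GH.ideal_axioms H']])
  then have *: "x \<otimes> y \<in> Idl (G <#> H)" if "x \<in> Idl G" "y \<in> Idl H" for x y
    using that H' m_comm[of x y] by (auto simp: subset_iff)
  show "ideal_prod R (Idl G) (Idl H) \<subseteq> Idl (G <#> H)"
  proof
    fix x assume "x \<in> ideal_prod R (Idl G) (Idl H)"
    then show "x \<in> Idl (G <#> H)" by induction (auto simp: * GH.a_closed)
  qed
  show "Idl (G <#> H) \<subseteq> ideal_prod R (Idl G) (Idl H)"
    using genideal_self[OF G] genideal_self[OF H]
    by (intro genideal_minimal ideal_prod_is_ideal genideal_ideal G H)
      (auto simp: set_mult_def intro: ideal_prod.prod)
qed

section \<open>Linear resolutions from based complexes\<close>

text \<open>Chains of all degrees share one function type and are told apart by their support, so a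
  single map can act as the differential in every degree.\<close>

definition cell_chains :: "'v set \<Rightarrow> 'c set \<Rightarrow> ('c \<Rightarrow> ('v, 'k::field) mpoly) set" where
  "cell_chains V C = {z. (\<forall>c. z c \<in> carrier (poly_ring V)) \<and> (\<forall>c. c \<notin> C \<longrightarrow> z c = 0)}"

lemma cell_chains_outside: "z \<in> cell_chains V C \<Longrightarrow> c \<notin> C \<Longrightarrow> z c = 0"
  and cell_chains_in_poly_ring: "z \<in> cell_chains V C \<Longrightarrow> z c \<in> carrier (poly_ring V)"
  by (simp_all add: cell_chains_def)

lemma zero_in_chains: "(\<lambda>_. 0) \<in> cell_chains V C"
  by (simp add: cell_chains_def zero_in_poly_ring)

lemma cell_chains_add: "z \<in> cell_chains V C \<Longrightarrow> w \<in> cell_chains V C \<Longrightarrow> (\<lambda>c. z c + w c) \<in> cell_chains V C"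
  by (auto simp: cell_chains_def intro: poly_ring_add_closed)

lemma cell_chains_diff: "z \<in> cell_chains V C \<Longrightarrow> w \<in> cell_chains V C \<Longrightarrow> (\<lambda>c. z c - w c) \<in> cell_chains V C"
  by (auto simp: cell_chains_def intro: poly_ring_diff_closed)

section \<open>Passage between chains and coordinate vectors\<close>

definition encode :: "'c list \<Rightarrow> ('c \<Rightarrow> 'a) \<Rightarrow> nat \<Rightarrow> 'a::zero" where
  "encode cs z = (\<lambda>j. if j < length cs then z (cs ! j) else 0)"

text \<open>For distinct \<open>cs\<close> the described index is unique, and this map inverts
  \<open>encode cs\<close>.\<close>

definition decode :: "'c list \<Rightarrow> (nat \<Rightarrow> 'a) \<Rightarrow> 'c \<Rightarrow> 'a::zero" where
  "decode cs w = (\<lambda>c. if c \<in> set cs then w (THE j. j < length cs \<and> cs ! j = c) else 0)"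

lemma decode_nth:
  assumes "distinct cs" "j < length cs"
  shows "decode cs w (cs ! j) = w j"
proof -
  have "(THE i. i < length cs \<and> cs ! i = cs ! j) = j"
    using assms by (intro the_equality) (auto simp: nth_eq_iff_index_eq)
  then show ?thesis using assms by (simp add: decode_def)
qed

lemma decode_cases:
  assumes "distinct cs"
  obtains "c \<notin> set cs" "decode cs w c = 0"
  | j where "j < length cs" "c = cs ! j" "decode cs w c = w j"
  using assms by (metis decode_def decode_nth in_set_conv_nth)

lemma decode_encode:
  assumes "distinct cs" "z \<in> cell_chains V (set cs)"
  shows "decode cs (encode cs z) = z"
proof
  fix c
  show "decode cs (encode cs z) c = z c"
    by (rule decode_cases[OF assms(1), of c "encode cs z"])
      (use assms(2) in \<open>auto simp: encode_def cell_chains_outside\<close>)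
qed

lemma encode_decode:
  assumes "distinct cs" "\<And>j. length cs \<le> j \<Longrightarrow> w j = 0"
  shows "encode cs (decode cs w) = w"
  using assms by (auto simp: encode_def decode_nth)

lemma carrier_free_module:
  "carrier (free_module V ss) =
     {w. (\<forall>j. w j \<in> carrier (poly_ring V)) \<and> (\<forall>j\<ge>length ss. w j = 0)}"
proof -
  have "w j \<in> carrier (poly_ring V)"
    if "\<forall>j<length ss. w j \<in> carrier (poly_ring V)" "\<forall>j\<ge>length ss. w j = 0" for w :: "nat \<Rightarrow> _" and j
    using that zero_in_poly_ring by (cases "j < length ss") auto
  then show ?thesis by (auto simp: free_module_def)
qed

lemma encode_in_free_module:
  "z \<in> cell_chains V (set cs) \<Longrightarrow> encode cs z \<in> carrier (free_module V (replicate (length cs) s))"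
  by (simp add: carrier_free_module encode_def cell_chains_in_poly_ring zero_in_poly_ring)

lemma decode_in_chains:
  assumes "distinct cs" "w \<in> carrier (free_module V (replicate (length cs) s))"
  shows "decode cs w \<in> cell_chains V (set cs)"
proof -
  have "decode cs w c \<in> carrier (poly_ring V) \<and> (c \<notin> set cs \<longrightarrow> decode cs w c = 0)" for c
    by (rule decode_cases[OF assms(1), of c w])
      (use assms(2) in \<open>auto simp: zero_in_poly_ring carrier_free_module\<close>)
  then show ?thesis by (simp add: cell_chains_def)
qed

lemma decode_add:
  fixes w w' :: "nat \<Rightarrow> 'a::monoid_add"
  shows "decode cs (\<lambda>j. w j + w' j) = (\<lambda>c. decode cs w c + decode cs w' c)"
  by (auto simp: decode_def)

lemma decode_mult:
  fixes w :: "nat \<Rightarrow> 'a::mult_zero"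
  shows "decode cs (\<lambda>j. f * w j) = (\<lambda>c. f * decode cs w c)"
  by (auto simp: decode_def)

lemma keys_decode:
  assumes "distinct cs" "w \<in> gr_comp (free_module V (replicate (length cs) s)) e"
    "m \<in> Poly_Mapping.keys (decode cs w c)"
  shows "mon_deg m + s = e"
  by (rule decode_cases[OF assms(1), of c w]) (use assms in \<open>auto simp: free_module_def\<close>)

text \<open>The cells of each degree are enumerated, those of degree \<open>i\<close> all get the
  shift \<open>d + i\<close>, and \<open>D\<close> and \<open>aug\<close> are conjugated by the
  enumeration. Linearity comes from \<open>D_deg\<close>: \<open>D\<close> raises polynomial degree
  by one, which is what a degree preserving map between shifts \<open>d + Suc i\<close> and
  \<open>d + i\<close> must do. Minimality comes from \<open>D_max\<close>.\<close>

lemma linear_resolutionI: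
  fixes C :: "nat \<Rightarrow> 'c set" and I :: "('v, 'k::field) mpoly set"
    and D :: "('c \<Rightarrow> ('v, 'k) mpoly) \<Rightarrow> 'c \<Rightarrow> ('v, 'k) mpoly" and aug
  assumes fin: "\<And>i. finite (C i)"
    and gen: "generated_in_degree V I d"
    and D_closed: "\<And>i z. z \<in> cell_chains V (C (Suc i)) \<Longrightarrow> D z \<in> cell_chains V (C i)"
    and D_add: "\<And>z w. D (\<lambda>c. z c + w c) = (\<lambda>c. D z c + D w c)"
    and D_mult: "\<And>f z. D (\<lambda>c. f * z c) = (\<lambda>c. f * D z c)"
    and D_deg: "\<And>z n e c m. (\<And>c m. m \<in> Poly_Mapping.keys (z c) \<Longrightarrow> mon_deg m + Suc n = e) \<Longrightarrow>
      m \<in> Poly_Mapping.keys (D z c) \<Longrightarrow> mon_deg m + n = e"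
    and D_max: "\<And>i z c. z \<in> cell_chains V (C (Suc i)) \<Longrightarrow> D z c \<in> max_graded_ideal V"
    and aug_add: "\<And>z w. aug (\<lambda>c. z c + w c) = aug z + aug w"
    and aug_mult: "\<And>f z. aug (\<lambda>c. f * z c) = f * aug z"
    and aug_deg: "\<And>z e m. (\<And>c m. m \<in> Poly_Mapping.keys (z c) \<Longrightarrow> mon_deg m + d = e) \<Longrightarrow>
      m \<in> Poly_Mapping.keys (aug z) \<Longrightarrow> mon_deg m = e"
    and aug_image: "aug ` cell_chains V (C 0) = I"
    and exact0: "D ` cell_chains V (C 1) = {z \<in> cell_chains V (C 0). aug z = 0}"
    and exact: "\<And>i. D ` cell_chains V (C (Suc (Suc i))) = {z \<in> cell_chains V (C (Suc i)). D z = (\<lambda>_. 0)}"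
  shows "has_linear_resolution V I"
proof -
  have "\<forall>i. \<exists>cs. set cs = C i \<and> distinct cs" using fin finite_distinct_list by blast
  then obtain cs where cs: "\<And>i. set (cs i) = C i" "\<And>i. distinct (cs i)" by metis
  define sh where "sh i = replicate (length (cs i)) (d + i)" for i
  define F where "F i = (free_module V (sh i) :: (('v, 'k) mpoly, nat \<Rightarrow> ('v, 'k) mpoly) graded_module)" for i
  define enc :: "nat \<Rightarrow> ('c \<Rightarrow> ('v, 'k) mpoly) \<Rightarrow> nat \<Rightarrow> ('v, 'k) mpoly" where "enc i = encode (cs i)" for i
  define dec :: "nat \<Rightarrow> (nat \<Rightarrow> ('v, 'k) mpoly) \<Rightarrow> 'c \<Rightarrow> ('v, 'k) mpoly" where "dec i = decode (cs i)" for i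
  have dec_enc: "dec i (enc i z) = z" if "z \<in> cell_chains V (C i)" for i z
    unfolding dec_def enc_def by (rule decode_encode) (use that cs in auto)
  have enc_dec: "enc i (dec i w) = w" if "w \<in> carrier (F i)" for i w
    unfolding dec_def enc_def
    by (rule encode_decode) (use that cs in \<open>auto simp: F_def sh_def carrier_free_module\<close>)
  have enc_F: "enc i z \<in> carrier (F i)" if "z \<in> cell_chains V (C i)" for i z
    unfolding enc_def F_def sh_def by (rule encode_in_free_module) (use that cs in auto)
  have dec_C: "dec i w \<in> cell_chains V (C i)" if "w \<in> carrier (F i)" for i w
    using decode_in_chains[OF cs(2)[of i], of w V "d + i"] that
    unfolding dec_def F_def sh_def by (simp add: cs)
  have dec_image: "dec i ` carrier (F i) = cell_chains V (C i)" for i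
    using dec_C dec_enc enc_F by (metis (no_types, lifting) image_subset_iff subsetI subset_antisym rev_image_eqI)
  have enc_0: "enc i z = (\<lambda>_. 0) \<longleftrightarrow> z = (\<lambda>_. 0)" if "z \<in> cell_chains V (C i)" for i z
  proof
    assume "enc i z = (\<lambda>_. 0)"
    then have "dec i (enc i z) = dec i (\<lambda>_. 0)" by simp
    then show "z = (\<lambda>_. 0)" unfolding dec_enc[OF that] by (simp add: dec_def decode_def)
  qed (simp add: enc_def encode_def)
  have dec_add: "dec i (\<lambda>j. w j + w' j) = (\<lambda>c. dec i w c + dec i w' c)" for i w w'
    unfolding dec_def by (rule decode_add)
  have dec_mult: "dec i (\<lambda>j. f * w j) = (\<lambda>c. f * dec i w c)" for i f w
    unfolding dec_def by (rule decode_mult)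
  have dec_deg: "mon_deg m + (d + i) = e"
    if "w \<in> gr_comp (F i) e" "m \<in> Poly_Mapping.keys (dec i w c)" for i w e m c
    using keys_decode[OF cs(2)[of i]] that unfolding F_def sh_def dec_def by blast
  have F_simps: "add (F i) = (\<lambda>w w' j. w j + w' j)" "smult (F i) = (\<lambda>f w j. f * w j)"
    "zero (F i) = (\<lambda>_. 0)" for i
    by (simp_all add: F_def free_module_def)
  \<comment> \<open>All shifts in \<open>sh i\<close> agree and zero coordinates have no monomials,
    so the degree condition may be imposed on every coordinate, also beyond the end of the
    list.\<close>
  have F_gr: "gr_comp (F i) e =
    {w \<in> carrier (F i). \<forall>j. \<forall>m\<in>Poly_Mapping.keys (w j). mon_deg m + (d + i) = e}" for i e
    unfolding F_def carrier_free_module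
    by (auto simp: free_module_def sh_def zero_in_poly_ring)
      (metis keys_zero empty_iff not_less zero_in_poly_ring)+
  define \<delta> where "\<delta> i w = enc i (D (dec (Suc i) w))" for i w
  define \<alpha> where "\<alpha> w = aug (dec 0 w)" for w
  have \<delta>_F: "\<delta> i w \<in> carrier (F i)" if "w \<in> carrier (F (Suc i))" for i w
    unfolding \<delta>_def by (intro enc_F D_closed dec_C that)
  have "\<delta> i \<in> graded_hom (poly_ring V) (F (Suc i)) (F i)" for i
  proof -
    have "\<delta> i w \<in> gr_comp (F i) e" if w: "w \<in> gr_comp (F (Suc i)) e" for w e
    proof -
      have "mon_deg m + (d + i) = e" if "m \<in> Poly_Mapping.keys (\<delta> i w j)" for m j
      proof (rule D_deg)
        show "mon_deg m + Suc (d + i) = e" if "m \<in> Poly_Mapping.keys (dec (Suc i) w c)" for m c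
          using dec_deg[OF w that] by simp
        show "m \<in> Poly_Mapping.keys (D (dec (Suc i) w) (cs i ! j))"
          using that by (simp add: \<delta>_def enc_def encode_def split: if_splits)
      qed
      then show ?thesis using w \<delta>_F by (auto simp: F_gr)
    qed
    then show ?thesis unfolding graded_hom_def using \<delta>_F
      by (auto simp: F_simps \<delta>_def dec_add dec_mult D_add D_mult enc_def encode_def)
  qed
  moreover have "\<alpha> \<in> graded_hom (poly_ring V) (F 0) (ideal_module I)"
  proof -
    have \<alpha>_I: "\<alpha> w \<in> I" if "w \<in> carrier (F 0)" for w
      unfolding \<alpha>_def using aug_image dec_C[OF that] by blast
    have "\<alpha> w \<in> gr_comp (ideal_module I) e" if w: "w \<in> gr_comp (F 0) e" for w e
    proof -
      have "mon_deg m = e" if "m \<in> Poly_Mapping.keys (\<alpha> w)" for m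
      proof (rule aug_deg)
        show "mon_deg m + d = e" if "m \<in> Poly_Mapping.keys (dec 0 w c)" for m c
          using dec_deg[OF w that] by simp
      qed (use that in \<open>simp add: \<alpha>_def\<close>)
      then show ?thesis using w \<alpha>_I by (auto simp: F_gr ideal_module_def homogeneous_def)
    qed
    then show ?thesis unfolding graded_hom_def using \<alpha>_I
      by (auto simp: F_simps \<alpha>_def dec_add dec_mult aug_add aug_mult ideal_module_def)
  qed
  moreover have "\<alpha> ` carrier (F 0) = I"
    unfolding \<alpha>_def aug_image[symmetric] dec_image[of 0, symmetric] by (simp add: image_image)
  moreover have \<delta>_image: "\<delta> i ` carrier (F (Suc i)) = enc i ` D ` cell_chains V (C (Suc i))" for i
    unfolding \<delta>_def dec_image[of "Suc i", symmetric] by (simp add: image_image)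
  \<comment> \<open>Transports kernels: a condition on decoded vectors corresponds under
    \<open>enc i\<close> to the same condition on chains.\<close>
  have F_image: "{w \<in> carrier (F i). Q (dec i w)} = enc i ` {z \<in> cell_chains V (C i). Q z}" for i Q
    using dec_C enc_dec dec_enc enc_F by (auto simp: image_iff) metis
  have "\<delta> 0 ` carrier (F 1) = a_kernel (F 0) (ideal_module I) \<alpha>"
    using F_image[of 0 "\<lambda>z. aug z = 0"] \<delta>_image[of 0] exact0
    by (simp add: a_kernel_def' \<alpha>_def ideal_module_def)
  moreover have "\<delta> (Suc i) ` carrier (F (Suc (Suc i))) = a_kernel (F (Suc i)) (F i) (\<delta> i)" for i
  proof -
    have "a_kernel (F (Suc i)) (F i) (\<delta> i) = {w \<in> carrier (F (Suc i)). D (dec (Suc i) w) = (\<lambda>_. 0)}"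
      unfolding a_kernel_def' F_simps \<delta>_def using enc_0 D_closed dec_C by blast
    also have "\<dots> = enc (Suc i) ` {z \<in> cell_chains V (C (Suc i)). D z = (\<lambda>_. 0)}"
      by (rule F_image)
    finally show ?thesis unfolding \<delta>_image exact by simp
  qed
  moreover have "\<forall>i. \<forall>w\<in>carrier (F (Suc i)). \<forall>j<length (sh i). \<delta> i w j \<in> max_graded_ideal V"
    using D_max[OF dec_C] by (auto simp: \<delta>_def enc_def encode_def sh_def)
  ultimately have "minimal_graded_free_resolution V I sh \<alpha> \<delta>"
    unfolding minimal_graded_free_resolution_def graded_free_resolution_def Let_def F_def by blast
  moreover have "\<forall>i. \<forall>s\<in>set (sh i). s = d + i" by (simp add: sh_def)
  ultimately show ?thesis unfolding has_linear_resolution_def using gen by blast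
qed

section \<open>Generators of the powers\<close>

text \<open>For \<open>k = 1\<close> these are the indicator functions of poset ideals. The value 0
  outside \<open>P\<close> makes a map determined by its restriction to \<open>P\<close>, hence the
  set finite for finite \<open>P\<close>.\<close>

definition order_reversing :: "'p set \<Rightarrow> 'p rel \<Rightarrow> nat \<Rightarrow> ('p \<Rightarrow> nat) set" where
  "order_reversing P r k =
     {a. (\<forall>p. p \<notin> P \<longrightarrow> a p = 0) \<and> (\<forall>p\<in>P. a p \<le> k) \<and>
         (\<forall>p\<in>P. \<forall>q\<in>P. (q, p) \<in> r \<longrightarrow> a p \<le> a q)}"

definition pow_exponent :: "'p set \<Rightarrow> nat \<Rightarrow> ('p \<Rightarrow> nat) \<Rightarrow> 'p xy \<Rightarrow>\<^sub>0 nat" where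
  "pow_exponent P k a =
     (\<Sum>p\<in>P. Poly_Mapping.single (X p) (a p) + Poly_Mapping.single (Y p) (k - a p))"

definition pow_monomial :: "'p set \<Rightarrow> nat \<Rightarrow> ('p \<Rightarrow> nat) \<Rightarrow> ('p xy, 'k::field) mpoly" where
  "pow_monomial P k a = Poly_Mapping.single (pow_exponent P k a) 1"

lemma lookup_pow_exponent:
  assumes "finite P"
  shows "Poly_Mapping.lookup (pow_exponent P k a) (X p) = (if p \<in> P then a p else 0)"
    and "Poly_Mapping.lookup (pow_exponent P k a) (Y p) = (if p \<in> P then k - a p else 0)"
  using assms by (simp_all add: pow_exponent_def lookup_sum lookup_add lookup_single when_def
      sum.delta cong: if_cong)

lemma xy_exponent_eqI:
  fixes m m' :: "'p xy \<Rightarrow>\<^sub>0 nat"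
  assumes "\<And>p. Poly_Mapping.lookup m (X p) = Poly_Mapping.lookup m' (X p)"
    and "\<And>p. Poly_Mapping.lookup m (Y p) = Poly_Mapping.lookup m' (Y p)"
  shows "m = m'"
proof (rule poly_mapping_eqI)
  show "Poly_Mapping.lookup m v = Poly_Mapping.lookup m' v" for v
    using assms by (cases v) auto
qed

lemma finite_order_reversing:
  assumes "finite P"
  shows "finite (order_reversing P r k)"
proof (rule finite_subset)
  show "order_reversing P r k \<subseteq> {a. \<forall>p. (p \<in> P \<longrightarrow> a p \<in> {..k}) \<and> (p \<notin> P \<longrightarrow> a p = 0)}"
    by (auto simp: order_reversing_def)
qed (rule finite_set_of_finite_funs[OF assms finite_atMost])

lemma keys_pow_exponent:
  "finite P \<Longrightarrow> Poly_Mapping.keys (pow_exponent P k a) \<subseteq> xy_vars P"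
proof
  fix v assume "finite P" "v \<in> Poly_Mapping.keys (pow_exponent P k a)"
  then show "v \<in> xy_vars P"
    by (cases v) (auto simp: in_keys_iff lookup_pow_exponent xy_vars_def split: if_splits)
qed

lemma pow_monomial_in_poly_ring:
  "finite P \<Longrightarrow> pow_monomial P k a \<in> carrier (poly_ring (xy_vars P))"
  using keys_pow_exponent by (simp add: pow_monomial_def poly_ring_def)

lemma mon_deg_pow_exponent:
  assumes "a \<in> order_reversing P r k"
  shows "mon_deg (pow_exponent P k a) = k * card P"
proof -
  have "mon_deg (pow_exponent P k a) = (\<Sum>p\<in>P. a p + (k - a p))"
    by (simp add: pow_exponent_def mon_deg_sum mon_deg_add)
  also have "\<dots> = (\<Sum>p\<in>P. k)"
    using assms by (intro sum.cong) (auto simp: order_reversing_def)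
  finally show ?thesis by simp
qed

section \<open>Products and factorizations of the generators\<close>

lemma u_monomial_eq:
  fixes I :: "'p set"
  assumes "finite P" "I \<subseteq> P"
  shows "u_monomial P I = (pow_monomial P 1 (\<lambda>p. if p \<in> I then 1 else 0) :: ('p xy, 'k::field) mpoly)"
proof -
  have *: "(\<Prod>i\<in>A. Poly_Mapping.single (f i) (1::'k)) = Poly_Mapping.single (sum f A) 1" for f :: "'p \<Rightarrow> 'p xy \<Rightarrow>\<^sub>0 nat" and A
    by (induction A rule: infinite_finite_induct) (simp_all add: mult_single flip: single_one)
  have fin: "finite I" using assms finite_subset by blast
  have "(\<Sum>p\<in>I. Poly_Mapping.single (X p) 1) + (\<Sum>p\<in>P - I. Poly_Mapping.single (Y p) 1) =
      pow_exponent P 1 (\<lambda>p. if p \<in> I then 1 else 0)"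
    by (rule xy_exponent_eqI)
      (use assms fin in \<open>auto simp: lookup_pow_exponent lookup_add lookup_sum lookup_single when_def sum.delta cong: if_cong\<close>)
  then show ?thesis
    by (simp add: u_monomial_def var_def * mult_single pow_monomial_def del: One_nat_def)
qed

lemma pow_monomial_mult:
  assumes "finite P" "a \<in> order_reversing P r k" "b \<in> order_reversing P r l"
  shows "pow_monomial P k a * pow_monomial P l b = pow_monomial P (k + l) (\<lambda>p. a p + b p)"
proof -
  \<comment> \<open>The bounds \<open>a p \<le> k\<close> and \<open>b p \<le> l\<close> let the
    truncated differences in the exponents of \<open>Y p\<close> add up.\<close>
  have "pow_exponent P k a + pow_exponent P l b = pow_exponent P (k + l) (\<lambda>p. a p + b p)"
    by (rule xy_exponent_eqI)
      (use assms in \<open>auto simp: lookup_pow_exponent lookup_add order_reversing_def\<close>)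
  then show ?thesis by (simp add: pow_monomial_def mult_single)
qed

lemma poset_ideal_indicator:
  assumes "I \<in> poset_ideals P r"
  shows "(\<lambda>p. if p \<in> I then 1 else 0) \<in> order_reversing P r 1"
  using assms by (auto simp: poset_ideals_def order_reversing_def)

text \<open>Values grow towards smaller elements of the poset, so the support is closed downwards
  and its indicator can be split off. Truncated subtraction is monotone, so what is left is again
  order reversing, with bound lowered to \<open>k\<close>.\<close>

lemma order_reversing_Suc_split:
  assumes "a \<in> order_reversing P r (Suc k)"
  defines "I \<equiv> {p \<in> P. a p \<noteq> 0}"
  shows "I \<in> poset_ideals P r" and "(\<lambda>p. a p - 1) \<in> order_reversing P r k"
    and "a = (\<lambda>p. (a p - 1) + (if p \<in> I then 1 else 0))"
proof -
  show "I \<in> poset_ideals P r"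
    using assms(1) unfolding poset_ideals_def order_reversing_def I_def by fastforce
  show "(\<lambda>p. a p - 1) \<in> order_reversing P r k"
    using assms by (auto simp: order_reversing_def intro: diff_le_mono)
  show "a = (\<lambda>p. (a p - 1) + (if p \<in> I then 1 else 0))"
    using assms by (auto simp: order_reversing_def I_def fun_eq_iff)
qed

lemma order_reversing_add:
  assumes "a \<in> order_reversing P r k" "b \<in> order_reversing P r l"
  shows "(\<lambda>p. a p + b p) \<in> order_reversing P r (k + l)"
  using assms by (auto simp: order_reversing_def intro: add_mono)

lemma order_reversing_min:
  assumes "a \<in> order_reversing P r k" "b \<in> order_reversing P r k"
  shows "(\<lambda>p. min (a p) (b p)) \<in> order_reversing P r k"
proof -
  have "min (a p) (b p) \<le> min (a q) (b q)" if "p \<in> P" "q \<in> P" "(q, p) \<in> r" for p q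
    using assms that by (intro min.mono) (auto simp: order_reversing_def)
  then show ?thesis using assms by (simp add: order_reversing_def min.coboundedI1)
qed

text \<open>Induction on \<open>k\<close>: the product of two ideals is generated by the products of
  generators, and by adding and splitting off indicators of poset ideals these are exactly the
  generators for the next power.\<close>

lemma H_ideal_power:
  fixes P :: "'p set" and r k
  defines "R \<equiv> poly_ring (xy_vars P) :: ('p xy, 'k::field) mpoly ring"
  assumes fin: "finite P"
  shows "H_ideal P r [^]\<^bsub>ideals_set R\<^esub> k = Idl\<^bsub>R\<^esub> (pow_monomial P k ` order_reversing P r k)"
proof (induction k)
  case 0
  interpret cring R unfolding R_def by (rule cring_poly_ring)
  \<comment> \<open>The zeroth power is the unit ideal; its only generator belongs to the zero map
    and equals 1.\<close>
  have "order_reversing P r 0 = {\<lambda>p. 0}" by (auto simp: order_reversing_def)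
  moreover have "pow_exponent P 0 (\<lambda>p. 0) = 0" by (simp add: pow_exponent_def)
  ultimately have "pow_monomial P 0 ` order_reversing P r 0 = {\<one>\<^bsub>R\<^esub>}"
    by (simp add: pow_monomial_def R_def)
  then show ?case using genideal_one by (simp add: nat_pow_def ideals_set_def)
next
  case (Suc k)
  interpret cring R unfolding R_def by (rule cring_poly_ring)
  let ?G = "pow_monomial P k ` order_reversing P r k :: ('p xy, 'k) mpoly set"
  let ?U = "u_monomial P ` poset_ideals P r :: ('p xy, 'k) mpoly set"
  have GU: "?G <#>\<^bsub>R\<^esub> ?U = pow_monomial P (Suc k) ` order_reversing P r (Suc k)"
  proof (intro equalityI subsetI)
    fix f assume "f \<in> ?G <#>\<^bsub>R\<^esub> ?U"
    then obtain a I where aI: "a \<in> order_reversing P r k" "I \<in> poset_ideals P r"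
      "f = pow_monomial P k a * u_monomial P I"
      by (auto simp: set_mult_def R_def)
    then have "f = pow_monomial P (Suc k) (\<lambda>p. a p + (if p \<in> I then 1 else 0))"
      using pow_monomial_mult[OF fin aI(1) poset_ideal_indicator[OF aI(2)]]
      by (simp add: u_monomial_eq[OF fin] poset_ideals_def)
    then show "f \<in> pow_monomial P (Suc k) ` order_reversing P r (Suc k)"
      using order_reversing_add[OF aI(1) poset_ideal_indicator[OF aI(2)]] by auto
  next
    fix f :: "('p xy, 'k) mpoly"
    assume "f \<in> pow_monomial P (Suc k) ` order_reversing P r (Suc k)"
    then obtain a where a: "a \<in> order_reversing P r (Suc k)" "f = pow_monomial P (Suc k) a" by auto
    let ?I = "{p \<in> P. a p \<noteq> 0}"
    note split = order_reversing_Suc_split[OF a(1)]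
    have "f = pow_monomial P k (\<lambda>p. a p - 1) * u_monomial P ?I"
      using pow_monomial_mult[OF fin split(2) poset_ideal_indicator[OF split(1)], where 'b = 'k]
      unfolding split(3)[symmetric] by (simp add: u_monomial_eq[OF fin] a(2))
    then show "f \<in> ?G <#>\<^bsub>R\<^esub> ?U"
      using split(1,2) by (auto simp: set_mult_def R_def)
  qed
  have "H_ideal P r [^]\<^bsub>ideals_set R\<^esub> Suc k = ideal_prod R (Idl\<^bsub>R\<^esub> ?G) (Idl\<^bsub>R\<^esub> ?U)"
    using Suc.IH by (simp add: nat_pow_def ideals_set_def H_ideal_def R_def)
  also have "\<dots> = Idl\<^bsub>R\<^esub> (?G <#>\<^bsub>R\<^esub> ?U)"
    by (rule ideal_prod_genideal)
      (auto simp: R_def fin pow_monomial_in_poly_ring u_monomial_in_poly_ring)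
  finally show ?case unfolding GU .
qed

section \<open>The cubical complex\<close>

text \<open>The terms at \<open>(s, t)\<close> and \<open>(t, s)\<close> cancel and the diagonal is
  left out. No division by two enters, so characteristic two is covered.\<close>

lemma sum_antisym_eq_0:
  fixes F :: "'a \<Rightarrow> 'a \<Rightarrow> 'b::comm_ring"
  assumes "finite A" "\<And>s t. s \<in> A \<Longrightarrow> t \<in> A \<Longrightarrow> s \<noteq> t \<Longrightarrow> F s t = - F t s"
  shows "(\<Sum>s\<in>A. \<Sum>t\<in>A - {s}. F s t) = 0"
  using assms
proof (induction A rule: finite_induct)
  case (insert x A)
  have "(\<Sum>s\<in>A. \<Sum>t\<in>insert x A - {s}. F s t) = (\<Sum>s\<in>A. F s x + (\<Sum>t\<in>A - {s}. F s t))"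
  proof (rule sum.cong)
    fix s assume "s \<in> A"
    then have "insert x A - {s} = insert x (A - {s})" using insert.hyps by auto
    then show "(\<Sum>t\<in>insert x A - {s}. F s t) = F s x + (\<Sum>t\<in>A - {s}. F s t)"
      using insert.hyps by simp
  qed simp
  also have "\<dots> = (\<Sum>s\<in>A. F s x)"
  proof -
    have "(\<Sum>s\<in>A. \<Sum>t\<in>A - {s}. F s t) = 0"
      by (rule insert.IH) (rule insert.prems, auto)
    then show ?thesis by (simp add: sum.distrib)
  qed
  also have "\<dots> = (\<Sum>s\<in>A. - F x s)"
  proof (rule sum.cong[OF refl])
    show "F s x = - F x s" if "s \<in> A" for s
      by (rule insert.prems) (use that insert.hyps in auto)
  qed
  finally show ?case using insert.hyps by (simp add: sum_negf)
qed simp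

text \<open>For \<open>s \<notin> T\<close> this is the usual incidence sign of the face
  \<open>T\<close> of \<open>insert s T\<close>, with respect to the order given by
  \<open>ord\<close>.\<close>

definition koszul_sign :: "('p \<Rightarrow> nat) \<Rightarrow> 'p set \<Rightarrow> 'p \<Rightarrow> 'a::comm_ring_1" where
  "koszul_sign ord T s = (- 1) ^ card {x \<in> T. ord x < ord s}"

lemma koszul_sign_square: "koszul_sign ord T s * koszul_sign ord T s = 1"
  by (simp add: koszul_sign_def flip: power_add)

lemma koszul_sign_cases: "koszul_sign ord T s = 1 \<or> koszul_sign ord T s = - 1"
  unfolding koszul_sign_def by (cases "even (card {x \<in> T. ord x < ord s})") auto

lemma koszul_sign_in_poly_ring: "koszul_sign ord T s \<in> carrier (poly_ring V)"
  by (cases "even (card {x \<in> T. ord x < ord s})")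
    (simp_all add: koszul_sign_def one_in_poly_ring poly_ring_uminus_closed)

lemma div_var_koszul_sign:
  fixes f :: "('v, 'k::field) mpoly"
  shows "div_var v (koszul_sign ord T s * f) = koszul_sign ord T s * div_var v f"
proof -
  consider "koszul_sign ord T s = (1 :: ('v, 'k) mpoly)" | "koszul_sign ord T s = (- 1 :: ('v, 'k) mpoly)"
    by (rule disjE[OF koszul_sign_cases])
  then show ?thesis by cases (simp_all add: div_var_uminus)
qed

lemma koszul_sign_insert:
  assumes "finite T" "s \<notin> T"
  shows "koszul_sign ord (insert s T) t =
    (if ord s < ord t then - koszul_sign ord T t else koszul_sign ord T t)"
proof (cases "ord s < ord t")
  case True
  then have "{x \<in> insert s T. ord x < ord t} = insert s {x \<in> T. ord x < ord t}" by auto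
  then show ?thesis using assms True by (simp add: koszul_sign_def)
next
  case False
  then have "{x \<in> insert s T. ord x < ord t} = {x \<in> T. ord x < ord t}" by auto
  then show ?thesis using False by (simp add: koszul_sign_def)
qed

text \<open>Exactly one of \<open>s\<close>, \<open>t\<close> precedes the other, so exactly one of
  the two insertions flips a sign.\<close>

lemma koszul_sign_swap:
  assumes "finite T" "s \<notin> T" "t \<notin> T" "ord s \<noteq> ord t"
  shows "koszul_sign ord T s * koszul_sign ord (insert s T) t =
    - (koszul_sign ord T t * koszul_sign ord (insert t T) s)"
  using assms by (auto simp: koszul_sign_insert mult.commute)

text \<open>Rewrites the relation of \<open>koszul_sign_swap\<close> by moving two signs to the
  opposite sides; this is possible because signs are their own inverses.\<close>

lemma sign_exchange:
  fixes a b c d :: "'a::comm_ring_1"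
  assumes "b * b = 1" "d * d = 1" "b * c = - (a * d)"
  shows "d * c = - (a * b)"
proof -
  have "d * c = (b * b) * (d * c)" by (simp add: assms(1))
  also have "\<dots> = (d * b) * (b * c)" by (simp only: mult_ac)
  also have "\<dots> = - ((d * d) * (a * b))" by (simp only: assms(3) mult_minus_right mult_ac)
  finally show ?thesis by (simp add: assms(2))
qed

section \<open>Cells, boundary and augmentation\<close>

definition incr :: "'p \<Rightarrow> ('p \<Rightarrow> nat) \<Rightarrow> 'p \<Rightarrow> nat" where "incr s a = a(s := Suc (a s))"

definition decr :: "'p \<Rightarrow> ('p \<Rightarrow> nat) \<Rightarrow> 'p \<Rightarrow> nat" where "decr s a = a(s := a s - 1)"

lemma decr_incr [simp]: "decr s (incr s a) = a"
  by (simp add: incr_def decr_def)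

lemma incr_decr: "a s \<noteq> 0 \<Longrightarrow> incr s (decr s a) = a"
  by (simp add: incr_def decr_def fun_upd_idem)

lemma incr_same [simp]: "incr s a s = Suc (a s)"
  by (simp add: incr_def)

lemma incr_commute: "incr s (incr t a) = incr t (incr s a)"
  by (auto simp: incr_def)

text \<open>The injection \<open>ord\<close> supplies a linear order on \<open>P\<close> for the
  signs; it need not be compatible with \<open>r\<close>.\<close>

locale poset_power =
  fixes P :: "'p set" and r :: "'p rel" and k :: nat and ord :: "'p \<Rightarrow> nat"
  assumes fin: "finite P" and po: "partial_order_on P r" and inj_ord: "inj_on ord P"
begin

abbreviation "S \<equiv> order_reversing P r k"

text \<open>The condition \<open>a t \<noteq> 0\<close> is essential: at a zero value the truncated
  \<open>decr t a\<close> is \<open>a\<close> itself and would count as an element of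
  \<open>S\<close>.\<close>

definition removable :: "('p \<Rightarrow> nat) \<Rightarrow> 'p set" where
  "removable a = {t \<in> P. a t \<noteq> 0 \<and> decr t a \<in> S}"

text \<open>Removability is asked of single elements only. It already yields the whole cube, since
  \<open>a\<close> lowered on a nonempty \<open>U \<subseteq> T\<close> is the pointwise minimum of
  the maps \<open>decr t a\<close> with \<open>t \<in> U\<close>.\<close>

definition cells :: "nat \<Rightarrow> (('p \<Rightarrow> nat) \<times> 'p set) set" where
  "cells i = {(a, T). a \<in> S \<and> T \<subseteq> removable a \<and> card T = i}"

abbreviation "chain i \<equiv> cell_chains (xy_vars P) (cells i)"

text \<open>Written dually, as coefficients of the result: the value at \<open>(a, T)\<close>
  collects the contributions of all cells having \<open>(a, T)\<close> as a facet, namely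
  \<open>(a, insert s T)\<close> and \<open>(incr s a, insert s T)\<close>. Since chains vanish off
  the cells, \<open>s\<close> may run through all of \<open>P - T\<close>.\<close>

definition boundary ::
  "(('p \<Rightarrow> nat) \<times> 'p set \<Rightarrow> ('p xy, 'k::field) mpoly) \<Rightarrow> ('p \<Rightarrow> nat) \<times> 'p set \<Rightarrow> ('p xy, 'k) mpoly"
  where "boundary z = (\<lambda>(a, T). \<Sum>s\<in>P - T. koszul_sign ord T s *
    (var (Y s) * z (a, insert s T) - var (X s) * z (incr s a, insert s T)))"

definition augment :: "(('p \<Rightarrow> nat) \<times> 'p set \<Rightarrow> ('p xy, 'k::field) mpoly) \<Rightarrow> ('p xy, 'k) mpoly" where
  "augment z = (\<Sum>a\<in>S. z (a, {}) * pow_monomial P k a)"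

lemma removable_subset: "removable a \<subseteq> P"
  by (auto simp: removable_def)

lemma finite_removable: "finite (removable a)"
  using removable_subset fin by (rule finite_subset)

lemma finite_cells: "finite (cells i)"
proof (rule finite_subset)
  show "cells i \<subseteq> S \<times> Pow P" using removable_subset by (auto simp: cells_def)
qed (simp add: fin finite_order_reversing)

lemma finite_cell: "(a, T) \<in> cells i \<Longrightarrow> finite T"
  by (rule finite_subset[OF _ finite_removable[of a]]) (simp add: cells_def)

lemma cells_face:
  assumes "(a, insert s T) \<in> cells (Suc i)" "s \<notin> T"
  shows "(a, T) \<in> cells i"
  using assms finite_cell[OF assms(1)] by (simp add: cells_def)

text \<open>Says that the lowered facet of a cell is a cell. The point is that each remaining
  direction stays removable after lowering at \<open>s\<close>, which follows from closure of order
  reversing maps under pointwise minima.\<close>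

lemma cells_face_incr:
  assumes "(incr s a, insert s T) \<in> cells (Suc i)" "s \<notin> T"
  shows "(a, T) \<in> cells i"
proof -
  have s: "s \<in> removable (incr s a)" and T: "T \<subseteq> removable (incr s a)" and c: "card T = i"
    using assms finite_cell[OF assms(1)] by (simp_all add: cells_def)
  have aS: "a \<in> S" using s by (simp add: removable_def)
  have "t \<in> removable a" if "t \<in> T" for t
  proof -
    have "t \<noteq> s" using that assms(2) by blast
    moreover have "t \<in> removable (incr s a)" using T that by blast
    ultimately have t: "t \<in> P" "t \<noteq> s" "a t \<noteq> 0" "decr t (incr s a) \<in> S"
      by (simp_all add: removable_def incr_def)
    have "decr t a = (\<lambda>p. min (a p) (decr t (incr s a) p))"
      using t(2) by (auto simp: decr_def incr_def fun_eq_iff)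
    also have "\<dots> \<in> S"
      by (rule order_reversing_min[OF aS t(4)])
    finally show ?thesis using t(1,3) by (simp add: removable_def)
  qed
  then show ?thesis using aS c by (auto simp: cells_def)
qed

lemma boundary_in_chain:
  fixes z :: "('p \<Rightarrow> nat) \<times> 'p set \<Rightarrow> ('p xy, 'k::field) mpoly"
  assumes "z \<in> chain (Suc i)"
  shows "boundary z \<in> chain i"
proof -
  note z = cell_chains_in_poly_ring[OF assms]
  have "var (X s) \<in> carrier (poly_ring (xy_vars P))" "var (Y s) \<in> carrier (poly_ring (xy_vars P))"
    if "s \<in> P" for s
    using that by (auto simp: xy_vars_def intro: var_in_poly_ring)
  then have "boundary z (a, T) \<in> carrier (poly_ring (xy_vars P))" for a T
    unfolding boundary_def prod.case
    by (intro poly_ring_sum_closed poly_ring_mult_closed koszul_sign_in_poly_ring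
        poly_ring_diff_closed z) auto
  then have "boundary z c \<in> carrier (poly_ring (xy_vars P))" for c
    by (cases c) simp
  moreover have "boundary z c = 0" if c: "c \<notin> cells i" for c
  proof (cases c)
    case (Pair a T)
    have "z (a, insert s T) = 0" if "s \<notin> T" for s
      by (rule cell_chains_outside[OF assms]) (use c cells_face[OF _ that] Pair in blast)
    moreover have "z (incr s a, insert s T) = 0" if "s \<notin> T" for s
      by (rule cell_chains_outside[OF assms]) (use c cells_face_incr[OF _ that] Pair in blast)
    ultimately show ?thesis by (simp add: Pair boundary_def)
  qed
  ultimately show ?thesis by (simp add: cell_chains_def)
qed

lemma boundary_add: "boundary (\<lambda>c. z c + w c) = (\<lambda>c. boundary z c + boundary w c)"
  by (simp add: boundary_def fun_eq_iff algebra_simps flip: sum.distrib)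

lemma boundary_mult: "boundary (\<lambda>c. f * z c) = (\<lambda>c. f * boundary z c)"
  by (simp add: boundary_def fun_eq_iff algebra_simps sum_distrib_left)

lemma boundary_diff: "boundary (\<lambda>c. z c - w c) = (\<lambda>c. boundary z c - boundary w c)"
  by (simp add: boundary_def fun_eq_iff right_diff_distrib sum.distrib sum_subtractf)

lemma augment_add: "augment (\<lambda>c. z c + w c) = augment z + augment w"
  by (simp add: augment_def algebra_simps sum.distrib)

lemma augment_mult: "augment (\<lambda>c. f * z c) = f * augment z"
  by (simp add: augment_def algebra_simps sum_distrib_left)

lemma augment_diff: "augment (\<lambda>c. z c - w c) = augment z - augment w"
  by (simp add: augment_def algebra_simps sum_subtractf)

section \<open>Consecutive maps compose to zero\<close>

lemma finite_face:
  assumes "z \<in> chain i" "z (a, T) \<noteq> 0"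
  shows "finite T"
proof (rule ccontr)
  assume "\<not> finite T"
  then have "(a, T) \<notin> cells i" using finite_cell by blast
  then show False using cell_chains_outside[OF assms(1)] assms(2) by blast
qed

text \<open>Raising at \<open>s\<close> and at \<open>t\<close> commute, as do the insertions, so
  the unsigned double term is symmetric in \<open>s\<close> and \<open>t\<close>. The product of the
  two signs is antisymmetric, and the double sum cancels.\<close>

lemma boundary_boundary:
  fixes z :: "('p \<Rightarrow> nat) \<times> 'p set \<Rightarrow> ('p xy, 'k::field) mpoly"
  assumes "z \<in> chain i"
  shows "boundary (boundary z) = (\<lambda>_. 0)"
proof (rule ext, clarify)
  fix a :: "'p \<Rightarrow> nat" and T :: "'p set"
  show "boundary (boundary z) (a, T) = 0"
  proof (cases "finite T")
    case False
    then have "z (b, insert s (insert t T)) = 0" for b s t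
      using finite_face[OF assms, of b "insert s (insert t T)"] False by (simp, blast)
    then show ?thesis by (simp add: boundary_def)
  next
    case True
    \<comment> \<open>\<open>G s t\<close> is the unsigned contribution of adding the direction
      \<open>s\<close> and then \<open>t\<close>.\<close>
    define G where "G s t =
      var (Y s) * (var (Y t) * z (a, insert t (insert s T)))
      - var (Y s) * (var (X t) * z (incr t a, insert t (insert s T)))
      - (var (X s) * (var (Y t) * z (incr s a, insert t (insert s T)))
      - var (X s) * (var (X t) * z (incr t (incr s a), insert t (insert s T))))" for s t
    have G_sym: "G s t = G t s" for s t
      by (simp add: G_def insert_commute incr_commute algebra_simps)
    have "boundary (boundary z) (a, T) = (\<Sum>s\<in>P - T. \<Sum>t\<in>(P - T) - {s}.
        koszul_sign ord T s * koszul_sign ord (insert s T) t * G s t)"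
    proof -
      have P_insert: "P - insert s T = (P - T) - {s}" for s by auto
      have "var (Y s) * boundary z (a, insert s T) - var (X s) * boundary z (incr s a, insert s T) =
          (\<Sum>t\<in>(P - T) - {s}. koszul_sign ord (insert s T) t * G s t)" for s
        unfolding boundary_def prod.case sum_distrib_left sum_subtractf[symmetric] P_insert
        by (rule sum.cong) (simp_all add: G_def algebra_simps)
      then show ?thesis
        unfolding boundary_def[of "boundary z"] prod.case by (simp add: sum_distrib_left mult.assoc)
    qed
    also have "\<dots> = 0"
    proof (rule sum_antisym_eq_0)
      fix s t assume st: "s \<in> P - T" "t \<in> P - T" "s \<noteq> t"
      then have "ord s \<noteq> ord t" using inj_on_eq_iff[OF inj_ord, of s t] by simp
      then have "koszul_sign ord T s * koszul_sign ord (insert s T) t =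
        - (koszul_sign ord T t * koszul_sign ord (insert t T) s :: ('p xy, 'k) mpoly)"
        using st True by (intro koszul_sign_swap) auto
      then show "koszul_sign ord T s * koszul_sign ord (insert s T) t * G s t =
        - (koszul_sign ord T t * koszul_sign ord (insert t T) s * G t s)"
        by (simp only: G_sym[of t s] mult_minus_left)
    qed (use fin in simp)
    finally show ?thesis .
  qed
qed

text \<open>Lowering \<open>a\<close> at \<open>s\<close> trades one factor \<open>X s\<close> for
  one factor \<open>Y s\<close>. These binomial relations between generators dictate the
  coefficients \<open>Y s\<close> and \<open>- X s\<close> in the boundary.\<close>

lemma var_mult_pow_monomial_decr:
  assumes "a \<in> S" "s \<in> P" "a s \<noteq> 0"
  shows "var (X s) * pow_monomial P k (decr s a) = var (Y s) * pow_monomial P k a"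
proof -
  \<comment> \<open>The bound ensures \<open>k - (a s - 1) = Suc (k - a s)\<close> in truncated
    arithmetic.\<close>
  have "a s \<le> k" using assms by (simp add: order_reversing_def)
  then have "Poly_Mapping.single (X s) 1 + pow_exponent P k (decr s a) =
      Poly_Mapping.single (Y s) 1 + pow_exponent P k a"
    by (intro xy_exponent_eqI)
      (use assms in \<open>auto simp: lookup_add lookup_single lookup_pow_exponent fin decr_def when_def\<close>)
  then show ?thesis by (simp only: var_def pow_monomial_def mult_single)
qed

text \<open>For each direction \<open>s\<close> the \<open>Y\<close>-terms and the
  \<open>X\<close>-terms have equal sums: both run over the edges in direction \<open>s\<close>,
  once indexed by the upper and once by the lower end, and the two terms of an edge agree by
  \<open>var_mult_pow_monomial_decr\<close>.\<close>

lemma augment_boundary: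
  fixes z :: "('p \<Rightarrow> nat) \<times> 'p set \<Rightarrow> ('p xy, 'k::field) mpoly"
  assumes "z \<in> chain 1"
  shows "augment (boundary z) = 0"
proof -
  let ?u = "pow_monomial P k"
  have z0: "z (a, {s}) = 0" if "a \<notin> S \<or> s \<notin> removable a" for a s
    using that by (intro cell_chains_outside[OF assms]) (auto simp: cells_def)
  have "augment (boundary z) =
      (\<Sum>a\<in>S. \<Sum>s\<in>P. var (Y s) * z (a, {s}) * ?u a) - (\<Sum>a\<in>S. \<Sum>s\<in>P. var (X s) * z (incr s a, {s}) * ?u a)"
    by (simp add: augment_def boundary_def koszul_sign_def sum_distrib_right sum_subtractf left_diff_distrib)
  also have "(\<Sum>a\<in>S. \<Sum>s\<in>P. var (X s) * z (incr s a, {s}) * ?u a) =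
      (\<Sum>s\<in>P. \<Sum>a\<in>S. var (X s) * z (incr s a, {s}) * ?u a)"
    by (rule sum.swap)
  also have "\<dots> = (\<Sum>s\<in>P. \<Sum>a\<in>S. var (Y s) * z (a, {s}) * ?u a)"
  proof (rule sum.cong[OF refl])
    fix s assume "s \<in> P"
    have "(\<Sum>a\<in>S. var (Y s) * z (a, {s}) * ?u a) =
        (\<Sum>a\<in>{a \<in> S. s \<in> removable a}. var (Y s) * z (a, {s}) * ?u a)"
      by (rule sum.mono_neutral_right) (use finite_order_reversing[OF fin] z0 in auto)
    \<comment> \<open>Passes from the upper to the lower end of each edge.\<close>
    also have "\<dots> = (\<Sum>a\<in>{a \<in> S. incr s a \<in> S}. var (X s) * z (incr s a, {s}) * ?u a)"
    proof (rule sum.reindex_bij_witness[of _ "incr s" "decr s"])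
      fix a assume a: "a \<in> {a \<in> S. s \<in> removable a}"
      then show "incr s (decr s a) = a" by (auto simp: removable_def incr_decr)
      show "decr s a \<in> {a \<in> S. incr s a \<in> S}" using a by (auto simp: removable_def incr_decr)
      show "var (X s) * z (incr s (decr s a), {s}) * ?u (decr s a) = var (Y s) * z (a, {s}) * ?u a"
      proof -
        have "var (X s) * ?u (decr s a) = (var (Y s) * ?u a :: ('p xy, 'k) mpoly)"
          using a by (intro var_mult_pow_monomial_decr) (auto simp: removable_def)
        then have "z (a, {s}) * (var (X s) * ?u (decr s a)) = z (a, {s}) * (var (Y s) * ?u a)"
          by (rule arg_cong[of _ _ "(*) (z (a, {s}))"])
        moreover have "incr s (decr s a) = a" using a by (auto simp: removable_def incr_decr)
        ultimately show ?thesis by (simp add: mult_ac)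
      qed
    qed (use \<open>s \<in> P\<close> in \<open>auto simp: removable_def\<close>)
    also have "\<dots> = (\<Sum>a\<in>S. var (X s) * z (incr s a, {s}) * ?u a)"
      by (rule sum.mono_neutral_left) (use finite_order_reversing[OF fin] z0 in auto)
    finally show "(\<Sum>a\<in>S. var (X s) * z (incr s a, {s}) * ?u a) =
        (\<Sum>a\<in>S. var (Y s) * z (a, {s}) * ?u a)" by simp
  qed
  also have "\<dots> = (\<Sum>a\<in>S. \<Sum>s\<in>P. var (Y s) * z (a, {s}) * ?u a)" by (rule sum.swap)
  finally show ?thesis by simp
qed

end

section \<open>Exactness\<close>

context poset_power begin

text \<open>Take \<open>t\<close> maximal in the poset among the elements where \<open>b\<close> is
  smaller than \<open>a\<close>. Lowering \<open>a\<close> at \<open>t\<close> could only fail at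
  some \<open>p\<close> above \<open>t\<close> with \<open>a p \<ge> a t\<close>; but then
  \<open>b p \<le> b t < a t \<le> a p\<close>, against maximality of \<open>t\<close>.\<close>

lemma removable_if_less:
  assumes "a \<in> S" "b \<in> S" "\<exists>p. b p < a p"
  obtains t where "t \<in> removable a" "b t < a t"
proof -
  let ?N = "{p \<in> P. b p < a p}"
  obtain p where p: "b p < a p" using assms(3) by blast
  then have "p \<in> ?N" using assms(1) by (cases "p \<in> P") (simp_all add: order_reversing_def)
  \<comment> \<open>A maximal element is found as one with the fewest elements of \<open>P\<close>
    above it.\<close>
  then obtain t where t: "t \<in> ?N"
      "\<And>p. p \<in> ?N \<Longrightarrow> card {q \<in> P. (t, q) \<in> r} \<le> card {q \<in> P. (p, q) \<in> r}"
    using ex_has_least_nat[of "\<lambda>p. p \<in> ?N" p "\<lambda>p. card {q \<in> P. (p, q) \<in> r}"] by blast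
  have max: "p = t" if p: "p \<in> ?N" "(t, p) \<in> r" for p
  proof (rule ccontr)
    assume "p \<noteq> t"
    then have "(p, t) \<notin> r"
      using po p(2) by (auto simp: partial_order_on_def dest: antisymD)
    moreover have "(t, t) \<in> r" and tr: "trans r"
      using po t(1) by (simp_all add: partial_order_on_def preorder_on_def refl_on_def)
    moreover have "{q \<in> P. (p, q) \<in> r} \<subseteq> {q \<in> P. (t, q) \<in> r}"
      using transD[OF tr p(2)] by blast
    ultimately have "{q \<in> P. (p, q) \<in> r} \<subset> {q \<in> P. (t, q) \<in> r}"
      using t(1) by blast
    then have "card {q \<in> P. (p, q) \<in> r} < card {q \<in> P. (t, q) \<in> r}"
      using fin by (intro psubset_card_mono) auto
    then show False using t(2)[OF p(1)] by simp
  qed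
  have "decr t a \<in> S"
  proof -
    have less: "a p < a t" if "p \<in> P" "(t, p) \<in> r" "p \<noteq> t" for p
    proof (rule ccontr)
      assume "\<not> a p < a t"
      moreover have "b p \<le> b t" using assms(2) t(1) that by (simp add: order_reversing_def)
      ultimately have "p \<in> ?N" using t(1) that by auto
      then show False using max that by blast
    qed
    have "decr t a p \<le> decr t a q" if "p \<in> P" "q \<in> P" "(q, p) \<in> r" for p q
    proof (cases "q = t \<and> p \<noteq> t")
      case True
      then have "a p < a t" using less[of p] that by simp
      then show ?thesis using True by (simp add: decr_def)
    next
      case False
      have "a p \<le> a q" using assms(1) that by (simp add: order_reversing_def)
      then show ?thesis using False by (auto simp: decr_def)
    qed
    moreover have "decr t a p \<le> k" if "p \<in> P" for p
      using assms(1) that le_trans[of "decr t a p" "a p" k]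
      by (simp add: order_reversing_def decr_def)
    moreover have "decr t a p = 0" if "p \<notin> P" for p
      using assms(1) t(1) that by (auto simp: order_reversing_def decr_def)
    ultimately show ?thesis by (simp add: order_reversing_def)
  qed
  then show thesis using that t(1) by (auto simp: removable_def)
qed

text \<open>In the relation \<open>augment z = 0\<close> the monomial \<open>u_a * m\<close> must
  also occur in the term of some other \<open>b\<close>. Since \<open>sum b P \<le> sum a P\<close>,
  this \<open>b\<close> is smaller than \<open>a\<close> somewhere, hence at some removable
  \<open>t\<close>. There \<open>u_b\<close> has more factors \<open>Y t\<close> than
  \<open>u_a\<close>, and the missing ones must come from \<open>m\<close>.\<close>

lemma leading_coefficient_divisible:
  fixes z :: "('p \<Rightarrow> nat) \<times> 'p set \<Rightarrow> ('p xy, 'k::field) mpoly"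
  assumes "augment z = 0" and B: "B \<subseteq> S" "\<And>b T. b \<notin> B \<Longrightarrow> z (b, T) = 0"
    and a: "a \<in> B" "\<And>b. b \<in> B \<Longrightarrow> sum b P \<le> sum a P"
    and m: "m \<in> Poly_Mapping.keys (z (a, {}))"
  shows "\<exists>t\<in>removable a. Poly_Mapping.lookup m (Y t) \<noteq> 0"
proof -
  have "augment z = (\<Sum>b\<in>B. z (b, {}) * pow_monomial P k b)"
    unfolding augment_def using B
    by (intro sum.mono_neutral_right) (auto simp: finite_order_reversing fin)
  also have "\<dots> = z (a, {}) * pow_monomial P k a + (\<Sum>b\<in>B - {a}. z (b, {}) * pow_monomial P k b)"
    using a(1) B finite_subset[OF B(1)] by (simp add: finite_order_reversing fin sum.remove)
  finally have eq: "pow_monomial P k a * z (a, {}) = (\<Sum>b\<in>B - {a}. - (pow_monomial P k b * z (b, {})))"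
    using assms(1) by (simp add: sum_negf mult.commute eq_neg_iff_add_eq_0)
  have "pow_exponent P k a + m \<in> Poly_Mapping.keys (pow_monomial P k a * z (a, {}))"
    unfolding pow_monomial_def keys_single_mult using m by blast
  then obtain b where b: "b \<in> B - {a}"
      "pow_exponent P k a + m \<in> Poly_Mapping.keys (- (pow_monomial P k b * z (b, {})))"
    unfolding eq using keys_sum by fast
  then obtain m' where m': "pow_exponent P k a + m = pow_exponent P k b + m'"
    by (auto simp: pow_monomial_def keys_single_mult)
  \<comment> \<open>Otherwise \<open>a \<le> b\<close> pointwise, and the comparison of sums would
    force \<open>a = b\<close>.\<close>
  have "\<exists>p. b p < a p"
  proof (rule ccontr)
    assume "\<nexists>p. b p < a p"
    then have le: "a p \<le> b p" for p by (simp add: not_less)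
    have "a p = b p" if "p \<in> P" for p
    proof (rule ccontr)
      assume "a p \<noteq> b p"
      then have "sum a P < sum b P" using le that fin
        by (intro sum_strict_mono_ex1) (auto intro!: bexI[of _ p] simp: order.not_eq_order_implies_strict)
      then show False using a(2)[of b] b(1) by simp
    qed
    moreover have "a p = b p" if "p \<notin> P" for p
    proof -
      have "a \<in> S" "b \<in> S" using a(1) b(1) B(1) by auto
      then show ?thesis using that by (simp add: order_reversing_def)
    qed
    ultimately have "a = b" by blast
    then show False using b(1) by simp
  qed
  then obtain t where t: "t \<in> removable a" "b t < a t"
    using removable_if_less[of a b] a(1) b(1) B(1) by blast
  then have "t \<in> P" "a t \<le> k" using removable_subset a(1) B(1) by (auto simp: order_reversing_def)
  moreover have "Poly_Mapping.lookup (pow_exponent P k a + m) (Y t) =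
      Poly_Mapping.lookup (pow_exponent P k b + m') (Y t)" by (simp only: m')
  ultimately have "Poly_Mapping.lookup m (Y t) \<noteq> 0"
    using t(2) by (simp add: lookup_add lookup_pow_exponent fin)
  then show ?thesis using t(1) by blast
qed

text \<open>In degree 0 the cycles are the kernel of the augmentation, so a single induction over
  the support \<open>B\<close> proves exactness at every place of the complex.\<close>

definition supported_cycle ::
  "nat \<Rightarrow> ('p \<Rightarrow> nat) set \<Rightarrow> (('p \<Rightarrow> nat) \<times> 'p set \<Rightarrow> ('p xy, 'k::field) mpoly) \<Rightarrow> bool"
  where "supported_cycle i B z \<longleftrightarrow> z \<in> chain i \<and> boundary z = (\<lambda>_. 0) \<and> (i = 0 \<longrightarrow> augment z = 0) \<and>
    (\<forall>b T. b \<notin> B \<longrightarrow> z (b, T) = 0)"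

text \<open>Guarantees that the faces of a cell over a map in \<open>B\<close> again lie over
  \<open>B\<close>, so that correcting by a boundary does not enlarge the support.\<close>

definition decr_closed :: "('p \<Rightarrow> nat) set \<Rightarrow> bool" where
  "decr_closed B \<longleftrightarrow> B \<subseteq> S \<and> (\<forall>a\<in>B. \<forall>t\<in>removable a. decr t a \<in> B)"

text \<open>
  The homotopy of the Koszul complex on the variables \<open>Y t\<close>, \<open>t \<in> removable a\<close>, that contracts the
  direction \<open>t\<close>. On the \<open>a\<close>-part of a cycle supported below \<open>a\<close>, the boundary is the Koszul
  differential.
\<close>

definition contraction ::
  "('p \<Rightarrow> nat) \<Rightarrow> 'p \<Rightarrow> (('p \<Rightarrow> nat) \<times> 'p set \<Rightarrow> ('p xy, 'k::field) mpoly) \<Rightarrow>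
   ('p \<Rightarrow> nat) \<times> 'p set \<Rightarrow> ('p xy, 'k) mpoly"
  where "contraction a t z = (\<lambda>(b, T). if b = a \<and> t \<in> T
    then koszul_sign ord (T - {t}) t * div_var (Y t) (z (a, T - {t})) else 0)"

lemma contraction_in_chain:
  fixes z :: "('p \<Rightarrow> nat) \<times> 'p set \<Rightarrow> ('p xy, 'k::field) mpoly"
  assumes z: "z \<in> chain i" and t: "t \<in> removable a"
  shows "contraction a t z \<in> chain (Suc i)"
proof -
  have "contraction a t z c \<in> carrier (poly_ring (xy_vars P))" for c
    unfolding contraction_def
    by (auto simp: split_beta zero_in_poly_ring intro!: poly_ring_mult_closed
        koszul_sign_in_poly_ring div_var_in_poly_ring cell_chains_in_poly_ring[OF z])
  moreover have "contraction a t z c = 0" if "c \<notin> cells (Suc i)" for c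
  proof (cases c)
    case (Pair b T)
    have "(a, T - {t}) \<notin> cells i" if "b = a" "t \<in> T"
    proof
      assume "(a, T - {t}) \<in> cells i"
      moreover from this have "card (insert t (T - {t})) = Suc (card (T - {t}))"
        by (intro card_insert_disjoint finite_cell) auto
      ultimately have "(a, insert t (T - {t})) \<in> cells (Suc i)"
        using t unfolding cells_def by auto
      then show False using \<open>c \<notin> cells (Suc i)\<close> Pair that by (simp add: insert_absorb)
    qed
    then show ?thesis using cell_chains_outside[OF z] by (auto simp: Pair contraction_def)
  qed
  ultimately show ?thesis by (simp add: cell_chains_def)
qed

text \<open>The correction \<open>z' = z - boundary (contraction a t z)\<close> changes
  \<open>z\<close> within its homology class. On the \<open>a\<close>-part the Koszul homotopy
  formula applies: components containing the direction \<open>t\<close> vanish, and the others are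
  replaced by their remainders modulo \<open>Y t\<close>.\<close>

lemma supported_cycle_contract:
  fixes z :: "('p \<Rightarrow> nat) \<times> 'p set \<Rightarrow> ('p xy, 'k::field) mpoly"
  assumes B: "decr_closed B" and z: "supported_cycle i B z"
    and a: "a \<in> B" "\<And>b. b \<in> B \<Longrightarrow> sum b P \<le> sum a P" and t: "t \<in> removable a"
  defines "z' \<equiv> (\<lambda>c. z c - boundary (contraction a t z) c)"
  shows "supported_cycle i B z'"
    and "\<And>T. z' (a, T) = (if t \<in> T then 0 else z (a, T) - var (Y t) * div_var (Y t) (z (a, T)))"
proof -
  let ?w = "contraction a t z"
  have zc: "z \<in> chain i" and dz: "boundary z = (\<lambda>_. 0)"
    and outside: "\<And>b T. b \<notin> B \<Longrightarrow> z (b, T) = 0"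
    using z by (auto simp: supported_cycle_def)
  have w: "?w \<in> chain (Suc i)" by (rule contraction_in_chain[OF zc t])
  have tP: "t \<in> P" using t removable_subset by blast
  \<comment> \<open>Maximality of \<open>sum a P\<close> removes all \<open>X\<close>-terms from the
    boundary at \<open>a\<close>, so only the Koszul differential in the variables
    \<open>Y s\<close> is left there.\<close>
  have incr_B: "incr s a \<notin> B" if "s \<in> P" for s
  proof -
    have "sum a P < sum (incr s a) P"
      using that fin by (intro sum_strict_mono_ex1) (auto simp: incr_def)
    then show ?thesis using a(2) by fastforce
  qed
  have incr_neq: "incr s a \<noteq> a" for s by (auto simp: incr_def fun_eq_iff)
  have "z' \<in> chain i" unfolding z'_def by (intro cell_chains_diff zc boundary_in_chain w)
  moreover have "boundary z' = (\<lambda>_. 0)"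
    unfolding z'_def boundary_diff by (simp add: dz boundary_boundary[OF w])
  moreover have "augment z' = 0" if "i = 0"
    using that z augment_boundary[of ?w] w
    unfolding z'_def augment_diff by (simp add: supported_cycle_def)
  moreover have "z' (b, T) = 0" if b: "b \<notin> B" for b T
  proof -
    have "?w (incr s b, insert s T) = 0" if s: "s \<in> P - T" for s
    proof (cases "incr s b = a")
      case True
      \<comment> \<open>If \<open>s\<close> were removable, lowering \<open>a\<close> at
        \<open>s\<close> would give \<open>b\<close>, which would then lie in \<open>B\<close> by
        closure.\<close>
      have "s \<notin> removable a"
      proof
        assume "s \<in> removable a"
        then have "decr s a \<in> B" using B a(1) unfolding decr_closed_def by blast
        moreover have "decr s a = b" using True by auto
        ultimately show False using b by simp
      qed
      then have "(incr s b, insert s T) \<notin> cells (Suc i)" by (simp add: True cells_def)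
      then show ?thesis by (rule cell_chains_outside[OF w])
    qed (simp add: contraction_def)
    moreover have "?w (b, insert s T) = 0" for s using b a(1) by (auto simp: contraction_def)
    ultimately have "boundary ?w (b, T) = 0" by (simp add: boundary_def)
    then show ?thesis by (simp add: z'_def outside b)
  qed
  ultimately show "supported_cycle i B z'" by (simp add: supported_cycle_def)
  fix T
  let ?e = "koszul_sign ord :: 'p set \<Rightarrow> 'p \<Rightarrow> ('p xy, 'k) mpoly"
  have w_sum: "boundary ?w (a, T) = (\<Sum>s\<in>P - T. ?e T s * (var (Y s) * ?w (a, insert s T)))"
    by (simp add: boundary_def contraction_def incr_neq)
  show "z' (a, T) = (if t \<in> T then 0 else z (a, T) - var (Y t) * div_var (Y t) (z (a, T)))"
  proof (cases "t \<in> T")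
    case False
    \<comment> \<open>With \<open>t \<notin> T\<close>, only the direction \<open>s = t\<close>
      produces a set containing \<open>t\<close>, where the contraction can be nonzero.\<close>
    have "boundary ?w (a, T) = (\<Sum>s\<in>{t}. ?e T s * (var (Y s) * ?w (a, insert s T)))"
      unfolding w_sum
      by (rule sum.mono_neutral_right) (use fin tP False in \<open>auto simp: contraction_def\<close>)
    also have "\<dots> = (?e T t * ?e T t) * (var (Y t) * div_var (Y t) (z (a, T)))"
      using False by (simp add: contraction_def mult_ac)
    finally show ?thesis using False by (simp add: z'_def koszul_sign_square)
  next
    case True
    show ?thesis
    proof (cases "finite T")
      case False
      then have "(a, T) \<notin> cells i"
        using finite_cell by blast
      then show ?thesis using True \<open>z' \<in> chain i\<close> by (simp add: cell_chains_outside)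
    next
      case fT: True
      define U where "U = T - {t}"
      have U: "t \<notin> U" "T = insert t U" "finite U" using True fT by (auto simp: U_def)
      \<comment> \<open>The cycle condition at \<open>(a, U)\<close>, divided by \<open>Y t\<close>,
        expresses \<open>z (a, T)\<close> through the quotients of the components
        \<open>(a, insert s U)\<close>. Exactly these quotients occur in the boundary of the
        contraction at \<open>(a, T)\<close>.\<close>
      have "0 = boundary z (a, U)" by (simp add: dz)
      also have "\<dots> = (\<Sum>s\<in>P - U. ?e U s * (var (Y s) * z (a, insert s U)))"
        by (simp add: boundary_def outside incr_B)
      also have "P - U = insert t (P - T)" using U tP by auto
      also have "(\<Sum>s\<in>insert t (P - T). ?e U s * (var (Y s) * z (a, insert s U))) =
          ?e U t * (var (Y t) * z (a, T)) + (\<Sum>s\<in>P - T. ?e U s * (var (Y s) * z (a, insert s U)))"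
        using U fin by simp
      finally have "div_var (Y t) 0 = div_var (Y t) (?e U t * (var (Y t) * z (a, T)) +
          (\<Sum>s\<in>P - T. ?e U s * (var (Y s) * z (a, insert s U))))" by simp
      also have "\<dots> = ?e U t * z (a, T) +
          (\<Sum>s\<in>P - T. ?e U s * (var (Y s) * div_var (Y t) (z (a, insert s U))))"
        using True
        by (simp add: div_var_add div_var_sum div_var_koszul_sign div_var_mult_self)
          (intro sum.cong refl, subst div_var_mult_other, auto)
      finally have rel: "(\<Sum>s\<in>P - T. ?e U s * (var (Y s) * div_var (Y t) (z (a, insert s U)))) =
          - (?e U t * z (a, T))"
        by (simp add: eq_neg_iff_add_eq_0 add.commute)
      have "boundary ?w (a, T) =
          (\<Sum>s\<in>P - T. - ?e U t * (?e U s * (var (Y s) * div_var (Y t) (z (a, insert s U)))))"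
        unfolding w_sum
      proof (rule sum.cong[OF refl])
        fix s assume s: "s \<in> P - T"
        then have st: "s \<noteq> t" "s \<notin> U" using True U by auto
        then have "insert s T - {t} = insert s U" using U by auto
        \<comment> \<open>The sign from the contraction, relative to \<open>insert s U\<close>, is
          compared with the sign in the cycle condition, relative to \<open>U\<close>.\<close>
        moreover have "?e T s * ?e (insert s U) t = - (?e U t * ?e U s)"
        proof -
          have "ord s \<noteq> ord t" using s tP st inj_on_eq_iff[OF inj_ord, of s t] by simp
          then have "?e U s * ?e (insert s U) t = - (?e U t * ?e T s)"
            unfolding U(2) using st U by (intro koszul_sign_swap) auto
          then show ?thesis
            by (rule sign_exchange[OF koszul_sign_square koszul_sign_square])
        qed
        moreover have "t \<in> insert s T" using True by simp
        ultimately have w_eq: "?w (a, insert s T) = ?e (insert s U) t * div_var (Y t) (z (a, insert s U))"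
          and sign: "?e T s * ?e (insert s U) t = - (?e U t * ?e U s)"
          by (simp_all add: contraction_def)
        have "?e T s * (var (Y s) * ?w (a, insert s T)) =
            (?e T s * ?e (insert s U) t) * (var (Y s) * div_var (Y t) (z (a, insert s U)))"
          unfolding w_eq by (simp only: mult_ac)
        also have "\<dots> = - ?e U t * (?e U s * (var (Y s) * div_var (Y t) (z (a, insert s U))))"
          unfolding sign by (simp only: mult_minus_left mult.assoc)
        finally show "?e T s * (var (Y s) * ?w (a, insert s T)) =
            - ?e U t * (?e U s * (var (Y s) * div_var (Y t) (z (a, insert s U))))" .
      qed
      also have "\<dots> = (?e U t * ?e U t) * z (a, T)"
        unfolding sum_distrib_left[symmetric] rel by (simp add: mult.assoc)
      finally show ?thesis using True by (simp add: z'_def koszul_sign_square)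
    qed
  qed
qed

text \<open>The directions in \<open>U\<close> are contracted one at a time. A later contraction
  keeps what has been achieved, because the new \<open>a\<close>-components are zero or contain only
  monomials of the old ones.\<close>

lemma supported_cycle_clear:
  fixes z :: "('p \<Rightarrow> nat) \<times> 'p set \<Rightarrow> ('p xy, 'k::field) mpoly"
  assumes B: "decr_closed B" and z: "supported_cycle i B z"
    and a: "a \<in> B" "\<And>b. b \<in> B \<Longrightarrow> sum b P \<le> sum a P" and U: "finite U" "U \<subseteq> removable a"
  shows "\<exists>w\<in>chain (Suc i). supported_cycle i B (\<lambda>c. z c - boundary w c) \<and>
    (\<forall>T m. m \<in> Poly_Mapping.keys (z (a, T) - boundary w (a, T)) \<longrightarrow>
      (\<forall>t\<in>U. t \<notin> T \<and> Poly_Mapping.lookup m (Y t) = 0))"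
  using U
proof (induction U rule: finite_induct)
  case empty
  then show ?case using z by (intro bexI[of _ "\<lambda>_. 0"]) (auto simp: zero_in_chains boundary_def)
next
  case (insert t U)
  then obtain w where w: "w \<in> chain (Suc i)" "supported_cycle i B (\<lambda>c. z c - boundary w c)"
      "\<And>T m s. m \<in> Poly_Mapping.keys (z (a, T) - boundary w (a, T)) \<Longrightarrow> s \<in> U \<Longrightarrow>
        s \<notin> T \<and> Poly_Mapping.lookup m (Y s) = 0"
    by auto
  define y where "y = (\<lambda>c. z c - boundary w c)"
  define w' where "w' = (\<lambda>c. w c + contraction a t y c)"
  have t: "t \<in> removable a" using insert.prems by simp
  have y: "supported_cycle i B y" using w(2) by (simp add: y_def)
  have eq: "(\<lambda>c. z c - boundary w' c) = (\<lambda>c. y c - boundary (contraction a t y) c)"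
    by (simp add: w'_def y_def boundary_add diff_diff_eq)
  note step = supported_cycle_contract[OF B y a t]
  have "w' \<in> chain (Suc i)"
    using y w(1) t unfolding w'_def supported_cycle_def
    by (intro cell_chains_add contraction_in_chain) auto
  moreover have "supported_cycle i B (\<lambda>c. z c - boundary w' c)" unfolding eq by (rule step(1))
  moreover have "s \<notin> T \<and> Poly_Mapping.lookup m (Y s) = 0"
    if m: "m \<in> Poly_Mapping.keys (z (a, T) - boundary w' (a, T))" and s: "s \<in> insert t U" for T m s
  proof -
    have "m \<in> Poly_Mapping.keys (y (a, T) - boundary (contraction a t y) (a, T))"
      using m fun_cong[OF eq, of "(a, T)"] by simp
    then have "m \<in> Poly_Mapping.keys
        (if t \<in> T then 0 else y (a, T) - var (Y t) * div_var (Y t) (y (a, T)))"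
      using step(2)[of T] by simp
    then have tT: "t \<notin> T" and "m \<in> Poly_Mapping.keys (y (a, T) - var (Y t) * div_var (Y t) (y (a, T)))"
      by (simp_all split: if_splits)
    then have "m \<in> Poly_Mapping.keys (y (a, T))" "Poly_Mapping.lookup m (Y t) = 0"
      using keys_diff_var_mult_div_var[of m "y (a, T)" "Y t"] by simp_all
    then show ?thesis using tT s w(3)[of m T s] unfolding y_def by blast
  qed
  ultimately show ?case by (intro bexI[of _ w'] conjI allI impI ballI) auto
qed

text \<open>Induction on the support: for \<open>a\<close> of maximal sum, clearing all removable
  directions makes the whole \<open>a\<close>-part vanish, and \<open>B - {a}\<close> remains. For a
  nonempty direction set this is acyclicity of the Koszul complex; in degree 0 it is
  \<open>leading_coefficient_divisible\<close>.\<close>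

lemma supported_cycle_is_boundary:
  fixes z :: "('p \<Rightarrow> nat) \<times> 'p set \<Rightarrow> ('p xy, 'k::field) mpoly"
  assumes "finite B" "decr_closed B" "supported_cycle i B z"
  shows "\<exists>w\<in>chain (Suc i). boundary w = z"
  using assms
proof (induction B arbitrary: z rule: finite_psubset_induct)
  case (psubset B)
  show ?case
  proof (cases "B = {}")
    case True
    then have "z = (\<lambda>_. 0)" using psubset.prems(2) by (auto simp: supported_cycle_def)
    then show ?thesis by (intro bexI[of _ "\<lambda>_. 0"]) (auto simp: boundary_def zero_in_chains)
  next
    case False
    then have "Max ((\<lambda>b. sum b P) ` B) \<in> (\<lambda>b. sum b P) ` B"
      using psubset.hyps by (intro Max_in) auto
    then obtain a where "a \<in> B" "Max ((\<lambda>b. sum b P) ` B) = sum a P" by blast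
    then have a: "a \<in> B" "\<And>b. b \<in> B \<Longrightarrow> sum b P \<le> sum a P"
      using psubset.hyps by (auto simp flip: \<open>Max _ = _\<close>)
    obtain w where w: "w \<in> chain (Suc i)" "supported_cycle i B (\<lambda>c. z c - boundary w c)"
        "\<And>T m t. m \<in> Poly_Mapping.keys (z (a, T) - boundary w (a, T)) \<Longrightarrow> t \<in> removable a \<Longrightarrow>
          t \<notin> T \<and> Poly_Mapping.lookup m (Y t) = 0"
      using supported_cycle_clear[OF psubset.prems a finite_removable subset_refl] by blast
    define y where "y = (\<lambda>c. z c - boundary w c)"
    have yc: "supported_cycle i B y" using w(2) by (simp add: y_def)
    have keys_y: "t \<notin> T \<and> Poly_Mapping.lookup m (Y t) = 0"
      if "m \<in> Poly_Mapping.keys (y (a, T))" "t \<in> removable a" for m t T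
      using w(3) that by (simp add: y_def)
    have "y (a, T) = 0" for T
    proof (rule ccontr)
      assume nz: "y (a, T) \<noteq> 0"
      then have "(a, T) \<in> cells i"
        using yc cell_chains_outside[of y "xy_vars P" "cells i" "(a, T)"]
        unfolding supported_cycle_def by blast
      then have T: "T \<subseteq> removable a" "card T = i" by (auto simp: cells_def)
      obtain m where m: "m \<in> Poly_Mapping.keys (y (a, T))"
        using nz by (metis keys_eq_empty ex_in_conv)
      \<comment> \<open>A surviving component has no removable direction, yet \<open>T\<close>
        consists of such directions. So the degree is 0 and the augmentation yields the
        contradiction.\<close>
      then have "T = {}" using T(1) keys_y by blast
      then have "augment y = 0" using T yc by (auto simp: supported_cycle_def)
      then obtain t where t: "t \<in> removable a" "Poly_Mapping.lookup m (Y t) \<noteq> 0"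
        using leading_coefficient_divisible[of y B a m] yc psubset.prems(1) a m \<open>T = {}\<close>
        by (auto simp: supported_cycle_def decr_closed_def)
      then show False using keys_y[OF m t(1)] by simp
    qed
    then have "supported_cycle i (B - {a}) y" using yc by (auto simp: supported_cycle_def)
    moreover have "decr_closed (B - {a})"
    proof -
      \<comment> \<open>Lowering strictly decreases the sum, so a map of maximal sum is never
        reached from \<open>B\<close> and may be deleted.\<close>
      have "decr t b \<noteq> a" if "b \<in> B" "t \<in> removable b" for b t
      proof
        assume "decr t b = a"
        moreover have "sum (decr t b) P < sum b P"
          using that fin by (intro sum_strict_mono_ex1) (auto simp: decr_def removable_def)
        ultimately show False using a(2)[OF that(1)] by simp
      qed
      then show ?thesis using psubset.prems(1) by (auto simp: decr_closed_def)
    qed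
    moreover have "B - {a} \<subset> B" using a(1) by blast
    ultimately obtain w' where w': "w' \<in> chain (Suc i)" "boundary w' = y"
      using psubset.IH by blast
    then have "boundary (\<lambda>c. w c + w' c) = z"
      by (simp add: boundary_add y_def)
    then show ?thesis using w(1) w'(1) cell_chains_add by blast
  qed
qed

lemma boundary_exact:
  assumes "z \<in> chain i" "boundary z = (\<lambda>_. 0)" "i = 0 \<Longrightarrow> augment z = 0"
  shows "\<exists>w\<in>chain (Suc i). boundary w = z"
proof (rule supported_cycle_is_boundary)
  show "finite S" by (rule finite_order_reversing[OF fin])
  show "decr_closed S" by (auto simp: decr_closed_def removable_def)
  have "z (b, T) = 0" if "b \<notin> S" for b T
    by (rule cell_chains_outside[OF assms(1)]) (use that in \<open>simp add: cells_def\<close>)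
  then show "supported_cycle i S z" using assms by (simp add: supported_cycle_def)
qed

lemma boundary_chain_0:
  assumes "z \<in> chain 0"
  shows "boundary z = (\<lambda>_. 0)"
proof (rule ext, clarify)
  fix a T
  have "(b, insert s T) \<notin> cells 0" for b s
  proof
    assume c: "(b, insert s T) \<in> cells 0"
    then have "card (insert s T) = 0" by (simp add: cells_def)
    then show False using finite_cell[OF c] by simp
  qed
  then show "boundary z (a, T) = 0" by (simp add: boundary_def cell_chains_outside[OF assms])
qed

end

section \<open>The linear resolution\<close>

lemma keys_koszul_sign_mult:
  fixes f :: "('v, 'k::field) mpoly"
  shows "Poly_Mapping.keys (koszul_sign ord T s * f) = Poly_Mapping.keys f"
  by (cases "even (card {x \<in> T. ord x < ord s})")
    (simp_all add: koszul_sign_def keys_minus_mpoly)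

context poset_power begin

section \<open>Degrees, minimality and the image of the augmentation\<close>

lemma mon_deg_boundary:
  fixes z :: "('p \<Rightarrow> nat) \<times> 'p set \<Rightarrow> ('p xy, 'k::field) mpoly"
  assumes z: "\<And>c m. m \<in> Poly_Mapping.keys (z c) \<Longrightarrow> mon_deg m + Suc n = e"
    and m: "m \<in> Poly_Mapping.keys (boundary z c)"
  shows "mon_deg m + n = e"
proof (cases c)
  case (Pair a T)
  have "m \<in> Poly_Mapping.keys (\<Sum>s\<in>P - T. koszul_sign ord T s *
      (var (Y s) * z (a, insert s T) - var (X s) * z (incr s a, insert s T)))"
    using m by (simp add: Pair boundary_def)
  from subsetD[OF keys_sum this] obtain s where "m \<in> Poly_Mapping.keys
      (var (Y s) * z (a, insert s T) - var (X s) * z (incr s a, insert s T))"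
    by (auto simp: keys_koszul_sign_mult)
  from subsetD[OF keys_diff this] consider "m \<in> Poly_Mapping.keys (var (Y s) * z (a, insert s T))"
    | "m \<in> Poly_Mapping.keys (var (X s) * z (incr s a, insert s T))"
    by blast
  then obtain v c' m' where m': "m' \<in> Poly_Mapping.keys (z c')" "m = Poly_Mapping.single v 1 + m'"
    by cases (auto simp: keys_var_mult)
  show ?thesis unfolding m'(2) using z[OF m'(1)] by (simp add: mon_deg_add)
qed

lemma mon_deg_augment:
  fixes z :: "('p \<Rightarrow> nat) \<times> 'p set \<Rightarrow> ('p xy, 'k::field) mpoly"
  assumes z: "\<And>c m. m \<in> Poly_Mapping.keys (z c) \<Longrightarrow> mon_deg m + k * card P = e"
    and m: "m \<in> Poly_Mapping.keys (augment z)"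
  shows "mon_deg m = e"
proof -
  have "m \<in> (\<Union>a\<in>S. Poly_Mapping.keys (z (a, {}) * pow_monomial P k a))"
    using subsetD[OF keys_sum m[unfolded augment_def]] .
  then obtain a m' where a: "a \<in> S" "m' \<in> Poly_Mapping.keys (z (a, {}))"
      "m = pow_exponent P k a + m'"
    by (auto simp: pow_monomial_def keys_single_mult mult.commute[of "z _"])
  show ?thesis unfolding a(3)
    using z[OF a(2)] mon_deg_pow_exponent[OF a(1)] by (simp add: mon_deg_add)
qed

lemma boundary_in_max_graded_ideal:
  fixes z :: "('p \<Rightarrow> nat) \<times> 'p set \<Rightarrow> ('p xy, 'k::field) mpoly"
  assumes "z \<in> chain i"
  shows "boundary z c \<in> max_graded_ideal (xy_vars P)"
proof -
  let ?R = "poly_ring (xy_vars P) :: ('p xy, 'k) mpoly ring"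
  interpret cring ?R by (rule cring_poly_ring)
  have vars: "var ` xy_vars P \<subseteq> carrier ?R" by (auto intro: var_in_poly_ring)
  interpret I: ideal "max_graded_ideal (xy_vars P)" ?R
    unfolding max_graded_ideal_def by (rule genideal_ideal[OF vars])
  have mult: "f * g \<in> max_graded_ideal (xy_vars P)"
    if "f \<in> carrier ?R" "g \<in> max_graded_ideal (xy_vars P)" for f g
    using I.I_l_closed that by simp
  have add: "f + g \<in> max_graded_ideal (xy_vars P)"
    if "f \<in> max_graded_ideal (xy_vars P)" "g \<in> max_graded_ideal (xy_vars P)"
    for f g :: "('p xy, 'k) mpoly"
    using I.a_closed that by simp
  have diff: "f - g \<in> max_graded_ideal (xy_vars P)"
    if "f \<in> max_graded_ideal (xy_vars P)" "g \<in> max_graded_ideal (xy_vars P)"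
    for f g :: "('p xy, 'k) mpoly"
    using add[OF that(1) mult[OF poly_ring_uminus_closed[OF one_in_poly_ring] that(2)]] by simp
  have sum: "sum h A \<in> max_graded_ideal (xy_vars P)"
    if "\<And>s. s \<in> A \<Longrightarrow> h s \<in> max_graded_ideal (xy_vars P)" for h :: "'p \<Rightarrow> ('p xy, 'k) mpoly" and A
    using that I.zero_closed by (induction A rule: infinite_finite_induct) (simp_all add: add)
  have var: "var v * f \<in> max_graded_ideal (xy_vars P)" if "v \<in> xy_vars P" "f \<in> carrier ?R" for v f
  proof -
    have "(var v :: ('p xy, 'k) mpoly) \<in> max_graded_ideal (xy_vars P)"
      unfolding max_graded_ideal_def by (intro subsetD[OF genideal_self[OF vars]] imageI that(1))
    from mult[OF that(2) this] show ?thesis by (simp add: mult.commute)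
  qed
  have "boundary z (a, T) \<in> max_graded_ideal (xy_vars P)" for a T
    unfolding boundary_def prod.case
    by (intro sum mult[OF koszul_sign_in_poly_ring] diff var cell_chains_in_poly_ring[OF assms])
      (auto simp: xy_vars_def)
  then show ?thesis by (cases c) simp
qed

lemma augment_image:
  "augment ` chain 0 = Idl\<^bsub>poly_ring (xy_vars P)\<^esub> (pow_monomial P k ` S :: ('p xy, 'k::field) mpoly set)"
proof -
  have "augment ` chain 0 =
      {\<Sum>a\<in>S. f a * pow_monomial P k a | f :: ('p \<Rightarrow> nat) \<Rightarrow> ('p xy, 'k) mpoly.
        \<forall>a. f a \<in> carrier (poly_ring (xy_vars P))}" (is "_ = ?R")
  proof (intro equalityI subsetI)
    fix x :: "('p xy, 'k) mpoly" assume "x \<in> augment ` chain 0"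
    then obtain z :: "('p \<Rightarrow> nat) \<times> 'p set \<Rightarrow> ('p xy, 'k) mpoly"
      where z: "z \<in> chain 0" "x = augment z" by blast
    show "x \<in> ?R" unfolding mem_Collect_eq
      by (rule exI[of _ "\<lambda>a. z (a, {})"])
        (use z in \<open>simp add: augment_def cell_chains_in_poly_ring\<close>)
  next
    fix x assume "x \<in> ?R"
    then obtain f :: "('p \<Rightarrow> nat) \<Rightarrow> ('p xy, 'k) mpoly"
      where f: "x = (\<Sum>a\<in>S. f a * pow_monomial P k a)" "\<forall>a. f a \<in> carrier (poly_ring (xy_vars P))"
      by blast
    \<comment> \<open>The cells of degree 0 are the pairs \<open>(a, {})\<close> with
      \<open>a \<in> S\<close>; the coefficients are extended by 0 to all other pairs.\<close>
    let ?z = "\<lambda>(a, T). if (a, T) \<in> cells 0 then f a else 0"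
    have "?z \<in> chain 0" using f(2) by (auto simp: cell_chains_def zero_in_poly_ring)
    moreover have "augment ?z = x" by (simp add: augment_def f(1) cells_def cong: sum.cong)
    ultimately show "x \<in> augment ` chain 0" by blast
  qed
  then show ?thesis
    by (simp add: Idl_image_eq_sums[OF finite_order_reversing[OF fin] pow_monomial_in_poly_ring[OF fin]])
qed

lemma power_has_linear_resolution:
  "has_linear_resolution (xy_vars P)
    (Idl\<^bsub>poly_ring (xy_vars P)\<^esub> (pow_monomial P k ` S :: ('p xy, 'k::field) mpoly set))"
proof (rule linear_resolutionI[where C = cells and D = boundary and aug = augment and d = "k * card P"])
  let ?I = "Idl\<^bsub>poly_ring (xy_vars P)\<^esub> (pow_monomial P k ` S :: ('p xy, 'k) mpoly set)"
  have "homogeneous (k * card P) (pow_monomial P k a :: ('p xy, 'k) mpoly)" if "a \<in> S" for a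
    using mon_deg_pow_exponent[OF that] by (simp add: homogeneous_def pow_monomial_def)
  then show "generated_in_degree (xy_vars P) ?I (k * card P)"
    unfolding generated_in_degree_def
    by (intro exI[of _ "pow_monomial P k ` S"]) (auto simp: pow_monomial_in_poly_ring fin)
  show "boundary ` chain 1 = {z \<in> chain 0. augment z = (0 :: ('p xy, 'k) mpoly)}"
  proof (intro equalityI subsetI)
    fix z :: "('p \<Rightarrow> nat) \<times> 'p set \<Rightarrow> ('p xy, 'k) mpoly"
    assume "z \<in> boundary ` chain 1"
    then show "z \<in> {z \<in> chain 0. augment z = 0}"
      by (elim imageE, hypsubst) (simp add: boundary_in_chain augment_boundary)
  next
    fix z :: "('p \<Rightarrow> nat) \<times> 'p set \<Rightarrow> ('p xy, 'k) mpoly"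
    assume z: "z \<in> {z \<in> chain 0. augment z = 0}"
    then have "\<exists>w\<in>chain (Suc 0). boundary w = z"
      by (intro boundary_exact boundary_chain_0) auto
    then show "z \<in> boundary ` chain 1" by auto
  qed
  show "boundary ` chain (Suc (Suc i)) =
      {z \<in> chain (Suc i). boundary z = (\<lambda>_. 0 :: ('p xy, 'k) mpoly)}" for i
  proof (intro equalityI subsetI)
    fix z :: "('p \<Rightarrow> nat) \<times> 'p set \<Rightarrow> ('p xy, 'k) mpoly"
    assume "z \<in> boundary ` chain (Suc (Suc i))"
    then show "z \<in> {z \<in> chain (Suc i). boundary z = (\<lambda>_. 0)}"
      by (elim imageE, hypsubst) (simp add: boundary_in_chain boundary_boundary)
  next
    fix z :: "('p \<Rightarrow> nat) \<times> 'p set \<Rightarrow> ('p xy, 'k) mpoly"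
    assume z: "z \<in> {z \<in> chain (Suc i). boundary z = (\<lambda>_. 0)}"
    then have "\<exists>w\<in>chain (Suc (Suc i)). boundary w = z" by (intro boundary_exact) auto
    then show "z \<in> boundary ` chain (Suc (Suc i))" by auto
  qed
qed (fact finite_cells boundary_in_chain boundary_add boundary_mult mon_deg_boundary
    boundary_in_max_graded_ideal augment_add augment_mult mon_deg_augment augment_image)+

end

theorem corollary1p3:
  fixes P :: "'p set" and r :: "'p rel" and k :: nat
  assumes "finite P" and "partial_order_on P r" and "k \<ge> 1"
  shows "has_linear_resolution (xy_vars P)
           (H_ideal P r [^]\<^bsub>ideals_set (poly_ring (xy_vars P) :: ('p xy, 'k::field) mpoly ring)\<^esub> k)"
proof -
  \<comment> \<open>Any injection of the finite set \<open>P\<close> into the naturals provides an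
    order for the signs.\<close>
  obtain ord :: "'p \<Rightarrow> nat" where "inj_on ord P"
    using finite_imp_inj_to_nat_seg[OF assms(1)] by blast
  then interpret poset_power P r k ord using assms(1,2) by unfold_locales
  show ?thesis
    unfolding H_ideal_power[OF assms(1)] by (rule power_has_linear_resolution)
qed

end
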